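(* Let $k$ be a field with algebraic closure $\bar{k}$, and let $A$ be a $k$-algebra. If there exists a finite-dimensional filtration $V=\{V_n : n\in\mathbb{N}\}$ on $A$ such that the associated graded algebra $B=\mathrm{gr}_V(A)$ has the property that $B\otimes_k \bar{k}$ is a (not necessarily commutative) domain, then $A$ is a finite factorization domain.
   Context: $\mathbb{N}$ includes $0$. Algebras are associative and unital, not necessarily commutative. A filtration on a $k$-algebra $A$ is a family $V=\{V_n : n\in\mathbb{N}\}$ of $k$-subspaces with $A=\bigcup_n V_n$, $V_n\subseteq V_m$ whenever $n\le m$, and $V_nV_m\subseteq V_{n+m}$ for all $n,m\ge 0$. It is finite-dimensional if each $V_n$ is a finite-dimensional $k$-vector space. The associated graded algebra is $\mathrm{gr}_V(A)=\bigoplus_{n\ge 0}V_n/V_{n-1}$ with $V_{-1}=\{0\}$, with the multiplication induced from $A$. A (not necessarily commutative) domain $A$ is a finite factorization domain (FFD) if every nonzero non-unit element of $A$ has at least one factorization $a=a_1\cdots a_m$ into irreducible elements (nonzero non-units that are not a product of two non-units) and at most finitely many distinct such factorizations up to multiplication of the irreducible factors by central units of $A$. (Factorizations are ordered sequences of factors.) *)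

theory Defs
  imports
    "HOL-Algebra.Algebraic_Closure_Type"
    "HOL-Algebra.Generated_Groups"
    "HOL-Library.Poly_Mapping"
    "HOL-Library.Set_Algebras"
begin

section \<open>Algebras over a field and filtrations\<close>

text \<open>The locale \<^locale>\<open>algebra\<close> of HOL-Algebra requires commutativity, so it is not used.\<close>

locale k_algebra = vector_space scale
  for scale :: "'k::field \<Rightarrow> 'a::ring_1 \<Rightarrow> 'a" +
  assumes scale_mult_left: "scale c x * y = scale c (x * y)"
    and scale_mult_right: "x * scale c y = scale c (x * y)"
begin

text \<open>The unit is not required to lie in \<open>V 0\<close>.\<close>

definition filtration :: "(nat \<Rightarrow> 'a set) \<Rightarrow> bool" where
  "filtration V \<longleftrightarrow>
     (\<forall>n. subspace (V n)) \<and>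
     (\<Union>n. V n) = UNIV \<and>
     (\<forall>n m. n \<le> m \<longrightarrow> V n \<subseteq> V m) \<and>
     (\<forall>n m. \<forall>x\<in>V n. \<forall>y\<in>V m. x * y \<in> V (n + m))"

definition finite_dim_filtration :: "(nat \<Rightarrow> 'a set) \<Rightarrow> bool" where
  "finite_dim_filtration V \<longleftrightarrow>
     filtration V \<and> (\<forall>n. \<exists>S. finite S \<and> span S = V n)"

end


section \<open>The associated graded algebra\<close>

text \<open>\<open>lower V n\<close> is $V_{n-1}$, with the convention $V_{-1} = 0$.\<close>

definition lower :: "(nat \<Rightarrow> 'a::zero set) \<Rightarrow> nat \<Rightarrow> 'a set" where
  "lower V n = (if n = 0 then {0} else V (n - 1))"

text \<open>
  An element of the direct sum is a family \<open>f\<close> of cosets, \<open>f n\<close> being a coset of \<open>lower V n\<close>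
  in \<open>V n\<close>, almost all of them zero. Sums and products of cosets are the elementwise ones of
  \<^theory>\<open>HOL-Library.Set_Algebras\<close>; adding \<open>lower V n\<close> turns the set of all products of
  representatives (respectively the scaled representatives) into a full coset.

  If \<open>1 \<notin> V 0\<close>, then \<open>one\<close> below is not in the carrier and \<open>gr scale V\<close> is not a ring.
\<close>

definition gr ::
  "('k \<Rightarrow> 'a \<Rightarrow> 'a) \<Rightarrow> (nat \<Rightarrow> 'a::ring_1 set) \<Rightarrow> ('k, nat \<Rightarrow> 'a set) module" where
  "gr scale V =
    \<lparr> carrier = {f. (\<forall>n. \<exists>a\<in>V n. f n = a +o lower V n) \<and> finite {n. f n \<noteq> lower V n}},
      monoid.mult = (\<lambda>f g n. \<Sum>i\<le>n. (f i * g (n - i) + lower V n)),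
      one = (\<lambda>n. if n = 0 then 1 +o lower V 0 else lower V n),
      ring.zero = (\<lambda>n. lower V n),
      add = (\<lambda>f g n. f n + g n),
      module.smult = (\<lambda>c f n. scale c ` f n + lower V n) \<rparr>"


section \<open>Tensor products of algebras\<close>

text \<open>
  The tensor product of two algebras over \<open>'k\<close> is the free abelian group on the pairs
  \<open>(b, c)\<close>, with the multiplication extending \<open>(b, c) (b', c') = (b b', c c')\<close> biadditively,
  modulo the additive subgroup generated by the usual relations (which is a two-sided ideal).
\<close>

definition tensor_free ::
  "('k, 'b) module \<Rightarrow> ('k, 'c) module \<Rightarrow> (('b \<times> 'c) \<Rightarrow>\<^sub>0 int) ring" where
  "tensor_free B C =
    \<lparr> carrier = {x. Poly_Mapping.keys x \<subseteq> carrier B \<times> carrier C},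
      monoid.mult = (\<lambda>x y. frag_extend (\<lambda>(b, c). frag_extend (\<lambda>(b', c').
          frag_of (b \<otimes>\<^bsub>B\<^esub> b', c \<otimes>\<^bsub>C\<^esub> c')) y) x),
      one = frag_of (\<one>\<^bsub>B\<^esub>, \<one>\<^bsub>C\<^esub>),
      ring.zero = 0,
      add = (+) \<rparr>"

definition tensor_relations ::
  "('k, 'b) module \<Rightarrow> ('k, 'c) module \<Rightarrow> (('b \<times> 'c) \<Rightarrow>\<^sub>0 int) set" where
  "tensor_relations B C =
     {frag_of (b \<oplus>\<^bsub>B\<^esub> b', c) - frag_of (b, c) - frag_of (b', c) | b b' c.
        b \<in> carrier B \<and> b' \<in> carrier B \<and> c \<in> carrier C} \<union>
     {frag_of (b, c \<oplus>\<^bsub>C\<^esub> c') - frag_of (b, c) - frag_of (b, c') | b c c'.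
        b \<in> carrier B \<and> c \<in> carrier C \<and> c' \<in> carrier C} \<union>
     {frag_of (r \<odot>\<^bsub>B\<^esub> b, c) - frag_of (b, r \<odot>\<^bsub>C\<^esub> c) | r b c.
        b \<in> carrier B \<and> c \<in> carrier C}"

definition tensor_algebra ::
  "('k, 'b) module \<Rightarrow> ('k, 'c) module \<Rightarrow> (('b \<times> 'c) \<Rightarrow>\<^sub>0 int) set ring" where
  "tensor_algebra B C =
     tensor_free B C Quot generate (add_monoid (tensor_free B C)) (tensor_relations B C)"

definition alg_closure_algebra :: "('k::field, 'k alg_closure) module" where
  "alg_closure_algebra =
    \<lparr> carrier = UNIV, monoid.mult = (*), one = 1, ring.zero = 0, add = (+),
      module.smult = (\<lambda>r x. to_ac r * x) \<rparr>"


section \<open>Noncommutative domains and finite factorization\<close>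

locale nc_domain = ring R for R (structure) +
  assumes one_not_zero: "\<one> \<noteq> \<zero>"
    and integral: "\<lbrakk>x \<in> carrier R; y \<in> carrier R; x \<otimes> y = \<zero>\<rbrakk> \<Longrightarrow> x = \<zero> \<or> y = \<zero>"

text \<open>\<^const>\<open>Units\<close> consists of the elements with a two-sided inverse.\<close>

definition nc_irreducible :: "('a, 'm) ring_scheme \<Rightarrow> 'a \<Rightarrow> bool" where
  "nc_irreducible R a \<longleftrightarrow>
     a \<in> carrier R \<and> a \<noteq> \<zero>\<^bsub>R\<^esub> \<and> a \<notin> Units R \<and>
     (\<forall>b\<in>carrier R. \<forall>c\<in>carrier R. a = b \<otimes>\<^bsub>R\<^esub> c \<longrightarrow> b \<in> Units R \<or> c \<in> Units R)"

definition central_units :: "('a, 'm) ring_scheme \<Rightarrow> 'a set" where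
  "central_units R = {u \<in> Units R. \<forall>x\<in>carrier R. u \<otimes>\<^bsub>R\<^esub> x = x \<otimes>\<^bsub>R\<^esub> u}"

definition factorizations :: "('a, 'm) ring_scheme \<Rightarrow> 'a \<Rightarrow> 'a list set" where
  "factorizations R a =
     {xs. (\<forall>x\<in>set xs. nc_irreducible R x) \<and> foldr (\<lambda>x y. x \<otimes>\<^bsub>R\<^esub> y) xs \<one>\<^bsub>R\<^esub> = a}"

definition factorization_equiv :: "('a, 'm) ring_scheme \<Rightarrow> 'a \<Rightarrow> ('a list \<times> 'a list) set" where
  "factorization_equiv R a =
     {(xs, ys). xs \<in> factorizations R a \<and> ys \<in> factorizations R a \<and>
        list_all2 (\<lambda>x y. \<exists>u\<in>central_units R. y = u \<otimes>\<^bsub>R\<^esub> x) xs ys}"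

definition finite_factorization_domain :: "('a, 'm) ring_scheme \<Rightarrow> bool" where
  "finite_factorization_domain R \<longleftrightarrow>
     nc_domain R \<and>
     (\<forall>a\<in>carrier R. a \<noteq> \<zero>\<^bsub>R\<^esub> \<and> a \<notin> Units R \<longrightarrow>
        factorizations R a \<noteq> {} \<and>
        finite (factorizations R a // factorization_equiv R a))"

end

(*
  Let b_n c_n = a be infinitely many factorizations with b_n, c_n in a finite-dimensional V_N, such
  that the tensors b_n (x) c_n are pairwise distinct. They define vectors b, c over an ultrapower L
  of K, the algebraic closure of k, with b c = a, and some coordinate x of b (x) c lies outside K.
  Extend 1/x |-> 0 to a place from L to K. After division by their dominant coordinates, b and c
  specialise to nonzero vectors over K, whose product is the specialisation of a multiple of a by a
  scalar divisible by 1/x, hence zero. But A (x) K has no zero divisors, because the product of the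
  leading forms of two elements is nonzero in gr(A) (x) K. So a has only finitely many left factors
  up to k*, and since the degree is additive and vanishes exactly on the units, induction on the
  degree bounds the factorizations.
*)

theory Submission
  imports Defs
begin

section \<open>Places into an algebraically closed field\<close>

text \<open>Behind the argument is a fact of projective geometry. Multiplication over
  \<open>K\<close> is bilinear without zero divisors, so the pairs of lines ([b], [c]) with b c on
  the line of a form a complete set, while the normalisation b c = a makes the set of tensors b
  \<otimes> c affine; a complete affine set is finite. The ultrapower provides a point of an
  infinite family outside \<open>K\<close>, and the place does the work of completeness. Tensors are
  forced: (t b, c / t) is again a factorization for every nonzero scalar t, so coordinates of b and
  c alone are not invariant, whereas the products of coordinates determine b up to a scalar. The
  limit vectors have coordinates in \<open>K\<close>, which is why zero divisors must be excluded
  over \<open>K\<close> and not just over k. The bound N is deg a: degrees add, so both factors lie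
  in \<open>V (deg a)\<close>. Nonzero elements of degree 0 are units because \<open>V 0\<close> is
  a finite-dimensional domain, hence a division ring.\<close>

locale field_embedding =
  fixes \<iota> :: "'k::field \<Rightarrow> 'l::field"
  assumes emb_add: "\<iota> (x + y) = \<iota> x + \<iota> y"
    and emb_mult: "\<iota> (x * y) = \<iota> x * \<iota> y"
    and emb_1: "\<iota> 1 = 1"
begin

lemma emb_0: "\<iota> 0 = 0"
  using emb_add[of 0 0] by (metis add_cancel_right_right add_0)

lemma emb_minus: "\<iota> (- x) = - \<iota> x"
  using emb_add[of x "- x"] by (simp add: emb_0 eq_neg_iff_add_eq_0 add.commute)

lemma emb_eq_0_iff: "\<iota> x = 0 \<longleftrightarrow> x = 0"
proof
  assume "\<iota> x = 0"
  then have "\<iota> (x * inverse x) = 0"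
    by (simp add: emb_mult)
  then show "x = 0"
    using emb_1 by (metis right_inverse zero_neq_one)
qed (simp add: emb_0)

definition eval_at :: "'l \<Rightarrow> 'k poly \<Rightarrow> 'l" where
  "eval_at y p = poly (map_poly \<iota> p) y"

lemma eval_at_0: "eval_at y 0 = 0"
  by (simp add: eval_at_def)

lemma eval_at_pCons: "eval_at y (pCons a p) = \<iota> a + y * eval_at y p"
  by (simp add: eval_at_def map_poly_pCons emb_0)

lemma eval_at_add: "eval_at y (p + q) = eval_at y p + eval_at y q"
  by (induction p q rule: poly_induct2)
    (simp_all add: eval_at_0 eval_at_pCons emb_add algebra_simps)

lemma eval_at_smult: "eval_at y (smult c p) = \<iota> c * eval_at y p"
  by (induction p) (simp_all add: eval_at_0 eval_at_pCons emb_mult algebra_simps)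

lemma eval_at_mult: "eval_at y (p * q) = eval_at y p * eval_at y q"
  by (induction p)
    (simp_all add: eval_at_0 eval_at_pCons eval_at_add eval_at_smult emb_0 algebra_simps)

text \<open>
  The graph of a homomorphism to \<open>'k\<close>, over \<open>'k\<close>, from a subring of \<open>'l\<close>: since it is closed
  under scaling, single-valuedness amounts to \<open>(0, 1)\<close> not being in it.
\<close>

definition partial_hom :: "('l \<times> 'k) set \<Rightarrow> bool" where
  "partial_hom G \<longleftrightarrow> (\<forall>c. (\<iota> c, c) \<in> G) \<and>
     (\<forall>x a y b. (x, a) \<in> G \<longrightarrow> (y, b) \<in> G \<longrightarrow> (x + y, a + b) \<in> G \<and> (x * y, a * b) \<in> G) \<and>
     (0, 1) \<notin> G"

text \<open>The ring generated by \<open>G\<close> and the pair \<open>(x, c)\<close>: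
  \<open>p\<close> and \<open>q\<close> are the two components of one polynomial with coefficients
  in \<open>G\<close>. What may break when \<open>x\<close> is sent to \<open>c\<close> is
  single-valuedness, that is, \<open>(0, 1)\<close> may appear.\<close>

definition adjoin :: "('l \<times> 'k) set \<Rightarrow> 'l \<Rightarrow> 'k \<Rightarrow> ('l \<times> 'k) set" where
  "adjoin G x c = {(poly p x, poly q c) | p q. \<forall>i. (coeff p i, coeff q i) \<in> G}"

text \<open>With M the set of elements that a partial homomorphism \<open>G\<close> sends to 0, this
  says that 1 lies in M + M x + ... + M x^n, the obstruction to extending \<open>G\<close> to
  \<open>x\<close> in Chevalley's extension theorem.\<close>

definition relation :: "('l \<times> 'k) set \<Rightarrow> 'l \<Rightarrow> nat \<Rightarrow> bool" where
  "relation G x n \<longleftrightarrow>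
     (\<exists>f. (\<forall>i. (f i, if i = 0 then 1 else 0) \<in> G) \<and> (\<Sum>i\<le>n. f i * x ^ i) = 0)"

context
  fixes G
  assumes G: "partial_hom G"
begin

lemma ph_emb: "(\<iota> c, c) \<in> G"
  using G by (simp add: partial_hom_def)

lemma ph_0: "(0, 0) \<in> G"
  using ph_emb[of 0] by (simp add: emb_0)

lemma ph_1: "(1, 1) \<in> G"
  using ph_emb[of 1] by (simp add: emb_1)

lemma ph_add: "(x, a) \<in> G \<Longrightarrow> (y, b) \<in> G \<Longrightarrow> (x + y, a + b) \<in> G"
  using G by (simp add: partial_hom_def)

lemma ph_mult: "(x, a) \<in> G \<Longrightarrow> (y, b) \<in> G \<Longrightarrow> (x * y, a * b) \<in> G"
  using G by (simp add: partial_hom_def)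

lemma ph_diff: "(x, a) \<in> G \<Longrightarrow> (y, b) \<in> G \<Longrightarrow> (x - y, a - b) \<in> G"
  using ph_add[of x a "\<iota> (- 1) * y" "(- 1) * b"] ph_mult[OF ph_emb[of "- 1"], of y b]
  by (simp add: emb_minus emb_1)

lemma ph_sum: "(\<And>i. i \<in> I \<Longrightarrow> (f i, g i) \<in> G) \<Longrightarrow> (sum f I, sum g I) \<in> G"
  by (induction I rule: infinite_finite_induct) (auto intro: ph_0 ph_add)

lemma ph_unique: assumes "(x, a) \<in> G" "(x, b) \<in> G" shows "a = b"
proof (rule ccontr)
  assume "a \<noteq> b"
  have "(0, a - b) \<in> G"
    using ph_diff[OF assms] by simp
  from ph_mult[OF this ph_emb[of "inverse (a - b)"]] have "(0, 1) \<in> G"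
    using \<open>a \<noteq> b\<close> by simp
  then show False
    using G by (simp add: partial_hom_def)
qed

lemma subset_adjoin: "G \<subseteq> adjoin G x c"
proof
  fix z assume "z \<in> G"
  then have "\<forall>i. (coeff [:fst z:] i, coeff [:snd z:] i) \<in> G"
    by (auto simp: coeff_pCons ph_0 split: nat.splits)
  then show "z \<in> adjoin G x c"
    unfolding adjoin_def by (intro CollectI exI[of _ "[:fst z:]"] exI[of _ "[:snd z:]"]) simp
qed

lemma adjoin_self: "(x, c) \<in> adjoin G x c"
proof -
  have "\<forall>i. (coeff [:0, 1:] i, coeff [:0, 1:] i) \<in> G"
    by (auto simp: coeff_pCons ph_0 ph_1 split: nat.splits)
  then show ?thesis
    unfolding adjoin_def by (intro CollectI exI[of _ "[:0, 1:]"]) simp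
qed

lemma partial_hom_adjoin:
  assumes "(0, 1) \<notin> adjoin G x c" shows "partial_hom (adjoin G x c)"
  unfolding partial_hom_def
proof (intro conjI allI impI)
  show "(\<iota> d, d) \<in> adjoin G x c" for d
    using subset_adjoin ph_emb by blast
  fix y a z b
  assume "(y, a) \<in> adjoin G x c" "(z, b) \<in> adjoin G x c"
  then obtain p q p' q' where
    p: "y = poly p x" "a = poly q c" "\<forall>i. (coeff p i, coeff q i) \<in> G" and
    p': "z = poly p' x" "b = poly q' c" "\<forall>i. (coeff p' i, coeff q' i) \<in> G"
    unfolding adjoin_def by blast
  show "(y + z, a + b) \<in> adjoin G x c"
    unfolding adjoin_def using p p'
    by (intro CollectI exI[of _ "p + p'"] exI[of _ "q + q'"]) (auto intro: ph_add)
  show "(y * z, a * b) \<in> adjoin G x c"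
    unfolding adjoin_def using p p'
    by (intro CollectI exI[of _ "p * p'"] exI[of _ "q * q'"])
      (auto simp: coeff_mult intro!: ph_mult ph_sum)
qed (fact assms)

lemma relation_mono: assumes "relation G x n" "n \<le> m" shows "relation G x m"
proof -
  obtain f where f: "\<And>i. (f i, if i = 0 then 1 else 0) \<in> G" "(\<Sum>i\<le>n. f i * x ^ i) = 0"
    using assms unfolding relation_def by blast
  have "(\<Sum>i\<le>m. (if i \<le> n then f i else 0) * x ^ i) = (\<Sum>i\<le>n. f i * x ^ i)"
    by (rule sum.mono_neutral_cong_right) (use assms in auto)
  then show ?thesis
    unfolding relation_def using f(1)[of 0] f(1)[of "Suc _"] f(2) ph_0
    by (intro exI[of _ "\<lambda>i. if i \<le> n then f i else 0"]) (auto simp: gr0_conv_Suc)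
qed

text \<open>Multiplied by x^n, the relation of \<open>inverse x\<close> becomes a polynomial
  relation of \<open>x\<close> whose leading coefficient \<open>g 0\<close> is sent to 1.
  Cross-multiplication with the first relation cancels x^n; the constant term is still sent to 1 and
  the other coefficients to 0.\<close>

lemma relation_descent:
  assumes "relation G x n" "relation G (inverse x) m" "m \<le> n" "x \<noteq> 0"
  shows "n > 0 \<and> relation G x (n - 1)"
proof -
  obtain f where f: "\<And>i. (f i, if i = 0 then 1 else 0) \<in> G" "(\<Sum>i\<le>n. f i * x ^ i) = 0"
    using assms unfolding relation_def by blast
  obtain g where g: "\<And>i. (g i, if i = 0 then 1 else 0) \<in> G"
      "(\<Sum>i\<le>n. g i * inverse x ^ i) = 0"
    using relation_mono[OF assms(2,3)] unfolding relation_def by blast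
  have n: "n > 0"
  proof (rule ccontr)
    assume "\<not> n > 0"
    with f(2) have "f 0 = 0"
      by simp
    with f(1)[of 0] show False
      using G by (simp add: partial_hom_def)
  qed
  define h where "h i = (if i < n then g 0 * f i - f n * g (n - i) else 0)" for i
  have h: "(h i, if i = 0 then 1 else 0) \<in> G" for i
  proof (cases "i < n")
    case True
    have "(h i, 1 * (if i = 0 then 1 else 0) - 0 * (if n - i = 0 then 1 else 0)) \<in> G"
      unfolding h_def if_P[OF True]
      by (intro ph_diff ph_mult f(1)) (use n f(1)[of n] g(1)[of 0] g(1)[of "n - i"] in simp_all)
    then show ?thesis
      by simp
  qed (use n in \<open>auto simp: h_def ph_0\<close>)
  have "(\<Sum>i\<le>n. g (n - i) * x ^ i) = x ^ n * (\<Sum>i\<le>n. g (n - i) * inverse x ^ (n - i))"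
    unfolding sum_distrib_left using \<open>x \<noteq> 0\<close>
    by (intro sum.cong) (auto simp: power_diff field_simps)
  also have "(\<Sum>i\<le>n. g (n - i) * inverse x ^ (n - i)) = 0"
    using g(2) sum.nat_diff_reindex[of "\<lambda>i. g i * inverse x ^ i" "Suc n"]
    by (simp add: lessThan_Suc_atMost)
  finally have rev: "(\<Sum>i\<le>n. g (n - i) * x ^ i) = 0"
    by simp
  have "(\<Sum>i\<le>n - 1. h i * x ^ i) = (\<Sum>i\<le>n. (g 0 * f i - f n * g (n - i)) * x ^ i)"
    using n by (cases n) (simp_all add: h_def)
  also have "\<dots> = g 0 * (\<Sum>i\<le>n. f i * x ^ i) - f n * (\<Sum>i\<le>n. g (n - i) * x ^ i)"
    by (simp add: sum_distrib_left sum_subtractf algebra_simps)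
  finally have "(\<Sum>i\<le>n - 1. h i * x ^ i) = 0"
    by (simp add: f(2) rev)
  then show ?thesis
    unfolding relation_def using n h by blast
qed

text \<open>Whichever relation is longer is shortened by the other, by symmetry in \<open>x\<close>
  and \<open>inverse x\<close>, and this descent on \<open>n + m\<close> could never stop. It is
  what makes the domain of a maximal \<open>G\<close> a valuation ring.\<close>

lemma not_both_relations:
  assumes "relation G x n" "relation G (inverse x) m" "x \<noteq> 0"
  shows False
  using assms
proof (induction "n + m" arbitrary: n m rule: less_induct)
  case less
  show False
  proof (cases "m \<le> n")
    case True
    with relation_descent[OF less.prems(1,2)] less show False
      by (metis add_less_mono1 diff_less less_numeral_extra(1))
  next
    case False
    with relation_descent[of "inverse x" m n] less show False
      by (metis add_strict_left_mono diff_less inverse_inverse_eq inverse_zero_imp_zero less_numeral_extra(1)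
        nat_le_linear)
  qed
qed

end

end

section \<open>Places with an algebraically closed residue field\<close>

locale place_embedding = field_embedding \<iota> for \<iota> :: "'k::alg_closed_field \<Rightarrow> 'l::field"
begin

text \<open>Linear factors can be split off \<open>p\<close> one at a time, and none of them
  vanishes at \<open>y\<close> because its root comes from \<open>'k\<close>. So every element
  outside the image of \<iota> is transcendental.\<close>

lemma eval_at_eq_0_imp:
  assumes "y \<notin> range \<iota>" "eval_at y p = 0"
  shows "p = 0"
  using assms(2)
proof (induction "degree p" arbitrary: p rule: less_induct)
  case less
  show ?case
  proof (cases "degree p = 0")
    case True
    then obtain c where "p = [:c:]"
      using degree_eq_zeroE by blast
    with less.prems show ?thesis
      by (simp add: eval_at_pCons eval_at_0 emb_eq_0_iff)
  next
    case False
    then obtain a where "poly p a = 0"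
      using alg_closed_imp_poly_has_root by blast
    then obtain q where q: "p = [:- a, 1:] * q"
      using poly_eq_0_iff_dvd by blast
    have "q \<noteq> 0"
      using False q by auto
    then have "degree p = Suc (degree q)"
      unfolding q by (subst degree_mult_eq) auto
    moreover have "eval_at y q = 0"
    proof -
      have "eval_at y [:- a, 1:] = y - \<iota> a"
        by (simp add: eval_at_pCons eval_at_0 emb_minus emb_1)
      moreover have "y - \<iota> a \<noteq> 0"
        using assms(1) by auto
      ultimately show ?thesis
        using less.prems unfolding q eval_at_mult by simp
    qed
    ultimately show ?thesis
      using less.hyps[of q] \<open>q \<noteq> 0\<close> by simp
  qed
qed

text \<open>
  The second components of the polynomial relations of \<open>x\<close> over \<open>G\<close> form an ideal of \<open>'k[X]\<close>;
  a generator of it either has a root, to which \<open>x\<close> can be sent, or is a unit.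
\<close>

lemma adjoin_or_relation:
  assumes G: "partial_hom G"
  shows "(\<exists>c. (0, 1) \<notin> adjoin G x c) \<or> (\<exists>n. relation G x n)"
proof -
  define J where "J = {q. \<exists>p. (\<forall>i. (coeff p i, coeff q i) \<in> G) \<and> poly p x = 0}"
  have J_diff: "q - r * q' \<in> J" if qq': "q \<in> J" "q' \<in> J" for q q' r
  proof -
    obtain p where p: "\<forall>i. (coeff p i, coeff q i) \<in> G" "poly p x = 0"
      using qq' by (auto simp: J_def)
    obtain p' where p': "\<forall>i. (coeff p' i, coeff q' i) \<in> G" "poly p' x = 0"
      using qq' by (auto simp: J_def)
    have "(coeff (p - map_poly \<iota> r * p') i, coeff (q - r * q') i) \<in> G" for i
      unfolding coeff_diff coeff_mult using p p'
      by (auto intro!: ph_diff[OF G] ph_sum[OF G] ph_mult[OF G] simp: coeff_map_poly emb_0 ph_emb[OF G])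
    with p p' show ?thesis
      unfolding J_def by (intro CollectI exI[of _ "p - map_poly \<iota> r * p'"]) auto
  qed
  show ?thesis
  proof (cases "\<exists>q\<in>J. q \<noteq> 0")
    case False
    \<comment> \<open>Without a nonzero polynomial in \<open>J\<close> the image of \<open>x\<close>
      is unconstrained; 0 is an arbitrary choice.\<close>
    have "(0, 1) \<notin> adjoin G x 0"
    proof
      assume "(0, 1) \<in> adjoin G x 0"
      then obtain p q where pq: "0 = poly p x" "1 = poly q 0" "\<forall>i. (coeff p i, coeff q i) \<in> G"
        unfolding adjoin_def by blast
      then have "q \<in> J"
        unfolding J_def by (intro CollectI exI[of _ p]) simp
      with False pq show False
        by (metis poly_0 zero_neq_one)
    qed
    then show ?thesis
      by blast
  next
    case True
    define d where "d = (LEAST d. \<exists>q\<in>J. q \<noteq> 0 \<and> degree q = d)"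
    have "\<exists>q\<in>J. q \<noteq> 0 \<and> degree q = d"
      unfolding d_def
      by (rule LeastI_ex[of "\<lambda>d. \<exists>q\<in>J. q \<noteq> 0 \<and> degree q = d"]) (use True in blast)
    then obtain q where q: "q \<in> J" "q \<noteq> 0" "degree q = d"
      by blast
    have dvd: "q dvd r" if r: "r \<in> J" for r
    proof -
      have "r mod q \<in> J"
        using J_diff[OF r q(1), of "r div q"] by (simp add: minus_div_mult_eq_mod)
      moreover have "r mod q = 0 \<or> degree (r mod q) < d"
        using degree_mod_less[OF q(2)] q(3) by simp
      ultimately have "r mod q = 0"
        using not_less_Least[of _ "\<lambda>d. \<exists>q\<in>J. q \<noteq> 0 \<and> degree q = d"] unfolding d_def[symmetric]
        by blast
      then show ?thesis
        by blast
    qed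
    show ?thesis
    proof (cases "d = 0")
      case False
      with q obtain c where c: "poly q c = 0"
        using alg_closed_imp_poly_has_root by blast
      have "(0, 1) \<notin> adjoin G x c"
      proof
        assume "(0, 1) \<in> adjoin G x c"
        then obtain p r where pr: "0 = poly p x" "1 = poly r c" "\<forall>i. (coeff p i, coeff r i) \<in> G"
          unfolding adjoin_def by blast
        then have "r \<in> J"
          unfolding J_def by (intro CollectI exI[of _ p]) simp
        from dvd[OF this] pr c show False
          by (auto elim!: dvdE)
      qed
      then show ?thesis
        by blast
    next
      case True
      with q obtain a where a: "q = [:a:]"
        using degree_eq_zeroE by blast
      with q have "a \<noteq> 0"
        by simp
      \<comment> \<open>This is \<open>inverse a\<close> times \<open>q\<close>, put in the shape
        \<open>q - r * q\<close> that \<open>J_diff\<close> handles.\<close>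
      then have "q - [:1 - inverse a:] * q = 1"
        unfolding a by (simp add: algebra_simps one_pCons)
      with J_diff[OF q(1) q(1), of "[:1 - inverse a:]"] have "1 \<in> J"
        by simp
      then obtain p where p: "\<forall>i. (coeff p i, coeff 1 i) \<in> G" "poly p x = 0"
        unfolding J_def by blast
      then have "relation G x (degree p)"
        unfolding relation_def
        by (intro exI[of _ "coeff p"]) (simp add: poly_altdef if_distrib of_bool_def)
      then show ?thesis
        by blast
    qed
  qed
qed

text \<open>Take a maximal extension. If neither \<open>y\<close> nor \<open>inverse y\<close> were
  in its domain, neither could be adjoined, so both would satisfy a relation, against
  \<open>not_both_relations\<close>.\<close>

lemma place_exists:
  assumes x: "x \<notin> range \<iota>"
  obtains G where "partial_hom G" "(inverse x, 0) \<in> G"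
    "\<And>y. (\<exists>c. (y, c) \<in> G) \<or> (\<exists>c. (inverse y, c) \<in> G)"
proof -
  have "inverse x \<notin> range \<iota>"
  proof
    assume "inverse x \<in> range \<iota>"
    then obtain c where c: "inverse x = \<iota> c"
      by blast
    have "x \<noteq> 0"
      using x emb_0 by (metis rangeI)
    with c have "c \<noteq> 0"
      by (auto simp: emb_0)
    then have "\<iota> c * \<iota> (inverse c) = 1"
      by (simp flip: emb_mult add: emb_1)
    then have "x = \<iota> (inverse c)"
      by (metis c inverse_inverse_eq inverse_unique)
    with x show False
      by blast
  qed
  note inv_x = eval_at_eq_0_imp[OF this]
  \<comment> \<open>The inverse of \<iota>. As \<open>inverse x\<close> is transcendental over its
    domain, sending it to 0 is consistent.\<close>
  define G0 where "G0 = range (\<lambda>c. (\<iota> c, c))"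
  have G0: "partial_hom G0"
    unfolding partial_hom_def G0_def
    by (auto simp: image_iff emb_add emb_mult) (metis emb_eq_0_iff zero_neq_one)
  define G1 where "G1 = adjoin G0 (inverse x) 0"
  have "(0, 1) \<notin> G1"
  proof
    assume "(0, 1) \<in> G1"
    then obtain p q where pq: "0 = poly p (inverse x)" "1 = poly q 0"
        "\<forall>i. (coeff p i, coeff q i) \<in> G0"
      unfolding G1_def adjoin_def by blast
    then have "p = map_poly \<iota> q"
      by (intro poly_eqI) (auto simp: coeff_map_poly emb_0 G0_def)
    with pq have "q = 0"
      using inv_x by (simp add: eval_at_def)
    with pq show False
      by simp
  qed
  then have G1: "partial_hom G1"
    unfolding G1_def by (rule partial_hom_adjoin[OF G0])
  define Exts where "Exts = {G. partial_hom G \<and> G1 \<subseteq> G}"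
  have "\<exists>M\<in>Exts. \<forall>Y\<in>Exts. M \<subseteq> Y \<longrightarrow> Y = M"
  proof (rule subset_Zorn_nonempty)
    show "Exts \<noteq> {}"
      using G1 by (auto simp: Exts_def)
    fix C assume C: "C \<noteq> {}" "subset.chain Exts C"
    have ph: "partial_hom G" "G1 \<subseteq> G" if "G \<in> C" for G
      using C that by (auto simp: Exts_def subset.chain_def)
    have dir: "\<exists>G\<in>C. u \<in> G \<and> v \<in> G" if "u \<in> \<Union> C" "v \<in> \<Union> C" for u v
    proof -
      from that obtain G H where GH: "G \<in> C" "u \<in> G" "H \<in> C" "v \<in> H"
        by auto
      then have "G \<subseteq> H \<or> H \<subseteq> G"
        using C(2) by (auto simp: subset.chain_def)
      with GH show ?thesis
        by blast
    qed
    have "partial_hom (\<Union> C)"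
      unfolding partial_hom_def
    proof (intro conjI allI impI)
      show "(\<iota> c, c) \<in> \<Union> C" for c
        using C(1) ph ph_emb by blast
      show "(0, 1) \<notin> \<Union> C"
        using ph by (auto simp: partial_hom_def)
      fix y a z b assume "(y, a) \<in> \<Union> C" "(z, b) \<in> \<Union> C"
      from dir[OF this] ph show "(y + z, a + b) \<in> \<Union> C" "(y * z, a * b) \<in> \<Union> C"
        by (meson UnionI ph_add ph_mult)+
    qed
    moreover have "G1 \<subseteq> \<Union> C"
      using C(1) ph by blast
    ultimately show "\<Union> C \<in> Exts"
      by (simp add: Exts_def)
  qed
  then obtain M where M: "partial_hom M" "G1 \<subseteq> M"
    and max: "\<And>Y. partial_hom Y \<Longrightarrow> M \<subseteq> Y \<Longrightarrow> Y = M"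
    unfolding Exts_def by (smt (verit) mem_Collect_eq subset_trans)
  have dom_or_relation: "(\<exists>c. (y, c) \<in> M) \<or> (\<exists>n. relation M y n)" for y
    using adjoin_or_relation[OF M(1), of y] max partial_hom_adjoin[OF M(1)] subset_adjoin[OF M(1)]
      adjoin_self[OF M(1)] by metis
  show thesis
  proof (rule that[OF M(1)])
    show "(inverse x, 0) \<in> M"
      using adjoin_self[OF G0, of "inverse x" 0] M(2) unfolding G1_def by blast
    \<comment> \<open>\<open>not_both_relations\<close> asks for a nonzero \<open>y\<close>; 0
      itself is in the domain by \<open>ph_0\<close>.\<close>
    show "(\<exists>c. (y, c) \<in> M) \<or> (\<exists>c. (inverse y, c) \<in> M)" for y
      using dom_or_relation[of y] dom_or_relation[of "inverse y"] not_both_relations[OF M(1)]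
        ph_0[OF M(1)] by blast
  qed
qed

text \<open>Divisibility in a valuation ring is total. If a new coordinate \<open>f t\<close> is not
  a multiple of the dominant \<open>f m\<close>, it becomes dominant itself, because f s / f t = (f
  s / f m) (f m / f t).\<close>

lemma dominant_coordinate:
  assumes G: "partial_hom G" and val: "\<And>y. (\<exists>c. (y, c) \<in> G) \<or> (\<exists>c. (inverse y, c) \<in> G)"
    and "finite S" "\<exists>s\<in>S. f s \<noteq> 0"
  shows "\<exists>m\<in>S. f m \<noteq> 0 \<and> (\<forall>s\<in>S. \<exists>c. (f s / f m, c) \<in> G)"
  using assms(3,4)
proof (induction S rule: finite_induct)
  case (insert t S)
  show ?case
  proof (cases "\<exists>s\<in>S. f s \<noteq> 0")
    case False
    with insert.prems show ?thesis
      using ph_0[OF G] ph_1[OF G] by (intro bexI[of _ t]) auto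
  next
    case True
    with insert.IH obtain m where m: "m \<in> S" "f m \<noteq> 0" "\<And>s. s \<in> S \<Longrightarrow> \<exists>c. (f s / f m, c) \<in> G"
      by blast
    show ?thesis
    proof (cases "\<exists>c. (f t / f m, c) \<in> G")
      case True
      with m show ?thesis
        by blast
    next
      case False
      with val[of "f t / f m"] obtain c where c: "(f m / f t, c) \<in> G"
        by auto
      have t: "f t \<noteq> 0"
        using False ph_0[OF G] by auto
      have "\<exists>c. (f s / f t, c) \<in> G" if "s \<in> insert t S" for s
      proof (cases "s = t")
        case False
        with that m obtain d where "(f s / f m, d) \<in> G"
          by blast
        from ph_mult[OF G this c] m show ?thesis
          by auto
      qed (use t ph_1[OF G] in auto)
      with t show ?thesis
        by blast
    qed
  qed
qed simp

end


section \<open>Ultrapowers and pure tensors\<close>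

text \<open>In the order on filters smaller means finer, so an ultrafilter is a minimal proper
  filter and Zorn's lemma is applied to the reversed order. Minimality decides each
  \<open>P\<close>: the infimum with the principal filter of \<open>P\<close> is either improper or
  the filter itself.\<close>

lemma ex_free_ultrafilter:
  "\<exists>F::nat filter. F \<le> sequentially \<and> F \<noteq> bot \<and> (\<forall>P. eventually P F \<or> eventually (\<lambda>n. \<not> P n) F)"
proof -
  define A where "A = {F::nat filter. F \<le> sequentially \<and> F \<noteq> bot}"
  have "\<exists>M\<in>A. \<forall>F\<in>A. M \<ge> F \<longrightarrow> F = M"
  proof (rule predicate_Zorn)
    show "partial_order_on A (relation_of (\<ge>) A)"
      by (auto simp: partial_order_on_def preorder_on_def refl_on_def trans_def antisym_def
          relation_of_def)
    fix C assume C: "C \<in> Chains (relation_of (\<ge>) A)"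
    then have chain: "\<And>F H. F \<in> C \<Longrightarrow> H \<in> C \<Longrightarrow> F \<le> H \<or> H \<le> F"
      by (auto simp: Chains_def relation_of_def)
    have CA: "C \<subseteq> A"
      using C by (auto simp: Chains_def relation_of_def)
    show "\<exists>U\<in>A. \<forall>F\<in>C. F \<ge> U"
    proof (cases "C = {}")
      case True
      then show ?thesis
        by (intro bexI[of _ sequentially]) (auto simp: A_def)
    next
      case False
      \<comment> \<open>Along a chain the events of the infimum are those of some member, so the
        infimum remains proper.\<close>
      have "eventually P (Inf C) \<longleftrightarrow> (\<exists>F\<in>C. eventually P F)" for P
        using False by (rule eventually_Inf_base) (metis chain inf.absorb1 inf.absorb2 order_refl)
      then have "Inf C \<noteq> bot"
        using CA by (auto simp: trivial_limit_def A_def)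
      moreover have "Inf C \<le> sequentially"
      proof -
        obtain F where "F \<in> C"
          using False by blast
        with CA show ?thesis
          by (auto simp: A_def intro: Inf_lower2)
      qed
      ultimately show ?thesis
        by (intro bexI[of _ "Inf C"]) (auto simp: A_def Inf_lower)
    qed
  qed
  then obtain M where M: "M \<le> sequentially" "M \<noteq> bot"
    and max: "\<And>F. F \<le> sequentially \<Longrightarrow> F \<noteq> bot \<Longrightarrow> F \<le> M \<Longrightarrow> F = M"
    by (auto simp: A_def)
  have "eventually P M \<or> eventually (\<lambda>n. \<not> P n) M" for P
  proof (cases "inf M (principal {n. P n}) = bot")
    case True
    then show ?thesis
      by (simp add: trivial_limit_def eventually_inf_principal)
  next
    case False
    then have "inf M (principal {n. P n}) = M"
      using M by (intro max) (auto intro: le_infI1)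
    moreover have "eventually P (inf M (principal {n. P n}))"
      by (simp add: eventually_inf_principal)
    ultimately show ?thesis
      by simp
  qed
  with M show ?thesis
    by blast
qed

text \<open>Fixed once and for all, since the relation of a quotient type cannot depend on a
  parameter.\<close>

definition free_ultrafilter :: "nat filter" where
  "free_ultrafilter = (SOME F. F \<le> sequentially \<and> F \<noteq> bot \<and>
     (\<forall>P. eventually P F \<or> eventually (\<lambda>n. \<not> P n) F))"

lemma free_ultrafilter:
  "free_ultrafilter \<le> sequentially" "free_ultrafilter \<noteq> bot"
  "eventually P free_ultrafilter \<or> eventually (\<lambda>n. \<not> P n) free_ultrafilter"
  using someI_ex[OF ex_free_ultrafilter] unfolding free_ultrafilter_def by blast+

\<comment> \<open>The ultrapower field and its diagonal subfield\<close>
quotient_type 'a ultrapower =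
  "nat \<Rightarrow> 'a" / "\<lambda>f g. eventually (\<lambda>n. f n = g n) free_ultrafilter"
proof (rule equivpI)
  show "symp (\<lambda>f g. \<forall>\<^sub>F n in free_ultrafilter. (f n::'a) = g n)"
    by (auto simp: symp_def elim: eventually_mono)
  show "transp (\<lambda>f g. \<forall>\<^sub>F n in free_ultrafilter. (f n::'a) = g n)"
    by (auto simp: transp_def elim: eventually_elim2)
qed (simp add: reflp_def)

instantiation ultrapower :: (field) field
begin

lift_definition zero_ultrapower :: "'a ultrapower" is "\<lambda>_. 0" .
lift_definition one_ultrapower :: "'a ultrapower" is "\<lambda>_. 1" .
lift_definition plus_ultrapower :: "'a ultrapower \<Rightarrow> 'a ultrapower \<Rightarrow> 'a ultrapower"
  is "\<lambda>f g n. f n + g n" by (auto elim: eventually_elim2)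
lift_definition minus_ultrapower :: "'a ultrapower \<Rightarrow> 'a ultrapower \<Rightarrow> 'a ultrapower"
  is "\<lambda>f g n. f n - g n" by (auto elim: eventually_elim2)
lift_definition times_ultrapower :: "'a ultrapower \<Rightarrow> 'a ultrapower \<Rightarrow> 'a ultrapower"
  is "\<lambda>f g n. f n * g n" by (auto elim: eventually_elim2)
lift_definition divide_ultrapower :: "'a ultrapower \<Rightarrow> 'a ultrapower \<Rightarrow> 'a ultrapower"
  is "\<lambda>f g n. f n / g n" by (auto elim: eventually_elim2)
lift_definition uminus_ultrapower :: "'a ultrapower \<Rightarrow> 'a ultrapower"
  is "\<lambda>f n. - f n" by (auto elim: eventually_mono)
lift_definition inverse_ultrapower :: "'a ultrapower \<Rightarrow> 'a ultrapower"
  is "\<lambda>f n. inverse (f n)" by (auto elim: eventually_mono)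

instance
proof
  fix x y z :: "'a ultrapower"
  show "x * y * z = x * (y * z)" by transfer (simp add: mult.assoc)
  show "x * y = y * x" by transfer (simp add: mult.commute)
  show "1 * x = x" by transfer simp
  show "x + y + z = x + (y + z)" by transfer (simp add: add.assoc)
  show "x + y = y + x" by transfer (simp add: add.commute)
  show "0 + x = x" by transfer simp
  show "- x + x = 0" by transfer simp
  show "x - y = x + - y" by transfer simp
  show "(x + y) * z = x * z + y * z" by transfer (simp add: distrib_right)
  show "(0::'a ultrapower) \<noteq> 1" by transfer (simp add: free_ultrafilter)
  show "x div y = x * inverse y" by transfer (simp add: divide_inverse)
  show "inverse (0::'a ultrapower) = 0" by transfer simp
  show "x \<noteq> 0 \<Longrightarrow> inverse x * x = 1"
  proof transfer
    fix f :: "nat \<Rightarrow> 'a"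
    assume "\<not> (\<forall>\<^sub>F n in free_ultrafilter. f n = 0)"
    with free_ultrafilter(3)[of "\<lambda>n. f n = 0"] have "\<forall>\<^sub>F n in free_ultrafilter. f n \<noteq> 0"
      by blast
    then show "\<forall>\<^sub>F n in free_ultrafilter. inverse (f n) * f n = 1"
      by (auto elim: eventually_mono)
  qed
qed

end

lemma abs_ultrapower_sum:
  fixes f :: "'i \<Rightarrow> nat \<Rightarrow> 'a::field"
  shows "(\<Sum>i\<in>I. abs_ultrapower (f i)) = abs_ultrapower (\<lambda>n. \<Sum>i\<in>I. f i n)"
  by (induction I rule: infinite_finite_induct)
    (simp_all add: zero_ultrapower_def plus_ultrapower.abs_eq)

interpretation ultrapower: place_embedding "\<lambda>c. abs_ultrapower (\<lambda>_. c::'k::alg_closed_field)"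
  by unfold_locales
    (simp_all add: plus_ultrapower.abs_eq times_ultrapower.abs_eq one_ultrapower_def)

text \<open>An injective sequence takes each value at most once, hence differs from any constant on
  a cofinite set, and a free ultrafilter contains all of these.\<close>

lemma inj_not_in_range_ultrapower:
  fixes Y :: "nat \<Rightarrow> 'a::field"
  assumes "inj Y"
  shows "abs_ultrapower Y \<notin> range (\<lambda>c. abs_ultrapower (\<lambda>_. c))"
proof
  assume "abs_ultrapower Y \<in> range (\<lambda>c. abs_ultrapower (\<lambda>_. c))"
  then obtain c where "eventually (\<lambda>n. Y n = c) free_ultrafilter"
    by (auto simp: ultrapower.abs_eq_iff)
  moreover have "finite {n. Y n = c}"
    using finite_vimageI[OF _ assms, of "{c}"] by (simp add: vimage_def)
  then have "eventually (\<lambda>n. Y n \<noteq> c) sequentially"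
    by (simp flip: cofinite_eq_sequentially add: eventually_cofinite)
  then have "eventually (\<lambda>n. Y n \<noteq> c) free_ultrafilter"
    using free_ultrafilter(1) by (rule filter_leD[rotated])
  ultimately have "eventually (\<lambda>_. False) free_ultrafilter"
    by eventually_elim simp
  then show False
    using free_ultrafilter(2) by (simp add: trivial_limit_def)
qed

text \<open>Here \<open>m s t\<close> holds the coordinates of the product of the basis elements
  \<open>s\<close> and \<open>t\<close>, and \<open>nz\<close> excludes zero divisors over
  \<open>'k\<close>. The claim concerns products \<alpha> i * \<beta> j because replacing \<alpha>,
  \<beta> by t \<alpha>, \<beta> / t keeps the equation.\<close>

lemma finite_pure_tensors:
  fixes m :: "'i \<Rightarrow> 'i \<Rightarrow> 'g \<Rightarrow> 'k::alg_closed_field"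
  assumes S: "finite S" "i \<in> S" "j \<in> S"
    and nz: "\<And>\<alpha> \<beta>. \<exists>s\<in>S. \<alpha> s \<noteq> 0 \<Longrightarrow> \<exists>t\<in>S. \<beta> t \<noteq> 0 \<Longrightarrow>
               \<exists>g. (\<Sum>s\<in>S. \<Sum>t\<in>S. \<alpha> s * \<beta> t * m s t g) \<noteq> 0"
  shows "finite {\<alpha> i * \<beta> j | \<alpha> \<beta>. \<forall>g. (\<Sum>s\<in>S. \<Sum>t\<in>S. \<alpha> s * \<beta> t * m s t g) = a g}"
    (is "finite ?T")
proof (rule ccontr)
  assume "infinite ?T"
  then obtain Y :: "nat \<Rightarrow> 'k" where Y: "inj Y" "range Y \<subseteq> ?T"
    using infinite_countable_subset by blast
  then have "\<forall>n. \<exists>\<alpha> \<beta>. Y n = \<alpha> i * \<beta> j \<and>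
      (\<forall>g. (\<Sum>s\<in>S. \<Sum>t\<in>S. \<alpha> s * \<beta> t * m s t g) = a g)"
    by blast
  then obtain \<alpha> where "\<forall>n. \<exists>\<beta>. Y n = \<alpha> n i * \<beta> j \<and>
      (\<forall>g. (\<Sum>s\<in>S. \<Sum>t\<in>S. \<alpha> n s * \<beta> t * m s t g) = a g)"
    by (rule choice[THEN exE])
  then obtain \<beta> where "\<forall>n. Y n = \<alpha> n i * \<beta> n j \<and>
      (\<forall>g. (\<Sum>s\<in>S. \<Sum>t\<in>S. \<alpha> n s * \<beta> n t * m s t g) = a g)"
    by (rule choice[THEN exE])
  then have Y_eq: "\<And>n. Y n = \<alpha> n i * \<beta> n j"
    and eq: "\<And>n g. (\<Sum>s\<in>S. \<Sum>t\<in>S. \<alpha> n s * \<beta> n t * m s t g) = a g"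
    by blast+
  define \<iota> where "\<iota> c = abs_ultrapower (\<lambda>_. c::'k)" for c
  interpret place_embedding \<iota>
    unfolding \<iota>_def by (rule ultrapower.place_embedding_axioms)
  define A B where "A s = abs_ultrapower (\<lambda>n. \<alpha> n s)"
    and "B s = abs_ultrapower (\<lambda>n. \<beta> n s)" for s
  define x where "x = abs_ultrapower Y"
  have x_eq: "x = A i * B j"
    by (simp add: x_def A_def B_def times_ultrapower.abs_eq Y_eq[abs_def])
  have x: "x \<notin> range \<iota>"
    using inj_not_in_range_ultrapower[OF Y(1)] by (simp add: x_def \<iota>_def[abs_def])
  then have "x \<noteq> 0"
    using emb_0 by (metis rangeI)
  have lim: "(\<Sum>s\<in>S. \<Sum>t\<in>S. A s * B t * \<iota> (m s t g)) = \<iota> (a g)" for g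
    by (simp add: A_def B_def \<iota>_def times_ultrapower.abs_eq abs_ultrapower_sum eq)
  obtain G where G: "partial_hom G" "(inverse x, 0) \<in> G"
    and val: "\<And>y. (\<exists>c. (y, c) \<in> G) \<or> (\<exists>c. (inverse y, c) \<in> G)"
    using place_exists[OF x] by blast
  have "\<exists>s\<in>S. A s \<noteq> 0" "\<exists>s\<in>S. B s \<noteq> 0"
    using \<open>x \<noteq> 0\<close> x_eq S by auto
  note AB = this
  obtain p where p: "p \<in> S" "A p \<noteq> 0" "\<forall>s\<in>S. \<exists>c. (A s / A p, c) \<in> G"
    using dominant_coordinate[OF G(1) val S(1) AB(1)] by blast
  obtain q where q: "q \<in> S" "B q \<noteq> 0" "\<forall>s\<in>S. \<exists>c. (B s / B q, c) \<in> G"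
    using dominant_coordinate[OF G(1) val S(1) AB(2)] by blast
  obtain \<alpha>' where \<alpha>': "\<And>s. s \<in> S \<Longrightarrow> (A s / A p, \<alpha>' s) \<in> G"
    using bchoice[OF p(3)] by blast
  obtain \<beta>' where \<beta>': "\<And>s. s \<in> S \<Longrightarrow> (B s / B q, \<beta>' s) \<in> G"
    using bchoice[OF q(3)] by blast
  \<comment> \<open>The dominant coordinates become 1, so neither limit vector is zero.\<close>
  have "\<alpha>' p = 1" "\<beta>' q = 1"
    using \<alpha>'[of p] \<beta>'[of q] p q ph_unique[OF G(1) _ ph_1[OF G(1)]] by simp_all
  moreover have "(\<Sum>s\<in>S. \<Sum>t\<in>S. \<alpha>' s * \<beta>' t * m s t g) = 0" for g
  proof (rule ph_unique[OF G(1)])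
    show "((\<Sum>s\<in>S. \<Sum>t\<in>S. (A s / A p) * (B t / B q) * \<iota> (m s t g)),
        (\<Sum>s\<in>S. \<Sum>t\<in>S. \<alpha>' s * \<beta>' t * m s t g)) \<in> G"
      by (intro ph_sum[OF G(1)] ph_mult[OF G(1)] \<alpha>' \<beta>' ph_emb[OF G(1)])
    have "(\<Sum>s\<in>S. \<Sum>t\<in>S. (A s / A p) * (B t / B q) * \<iota> (m s t g)) =
        (\<Sum>s\<in>S. \<Sum>t\<in>S. A s * B t * \<iota> (m s t g)) / (A p * B q)"
      by (simp add: sum_divide_distrib)
    \<comment> \<open>As x = A i * B j, dividing by A p * B q amounts to multiplying by two
      quotients in the domain of \<open>G\<close> and by \<open>inverse x\<close>, which is sent to
      0.\<close>
    also have "\<dots> = \<iota> (a g) * ((A i / A p) * (B j / B q)) * inverse x"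
      unfolding lim using x_eq \<open>x \<noteq> 0\<close> by (simp add: field_simps)
    finally show "((\<Sum>s\<in>S. \<Sum>t\<in>S. (A s / A p) * (B t / B q) * \<iota> (m s t g)), 0) \<in> G"
      using ph_mult[OF G(1) ph_mult[OF G(1) ph_emb[OF G(1), of "a g"]
          ph_mult[OF G(1) \<alpha>'[OF S(2)] \<beta>'[OF S(3)]]] G(2)] by simp
  qed
  ultimately show False
    using nz[of \<alpha>' \<beta>'] p(1) q(1) by (metis zero_neq_one)
qed


section \<open>The tensor product\<close>

locale tensor_factors =
  fixes B :: "('k, 'b) module" and C :: "('k, 'c) module"
  assumes B_add: "b \<in> carrier B \<Longrightarrow> b' \<in> carrier B \<Longrightarrow> b \<oplus>\<^bsub>B\<^esub> b' \<in> carrier B"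
    and B_smult: "b \<in> carrier B \<Longrightarrow> r \<odot>\<^bsub>B\<^esub> b \<in> carrier B"
    and C_add: "c \<in> carrier C \<Longrightarrow> c' \<in> carrier C \<Longrightarrow> c \<oplus>\<^bsub>C\<^esub> c' \<in> carrier C"
    and C_smult: "c \<in> carrier C \<Longrightarrow> r \<odot>\<^bsub>C\<^esub> c \<in> carrier C"
begin

definition null :: "(('b \<times> 'c) \<Rightarrow>\<^sub>0 int) set" where
  "null = generate (add_monoid (tensor_free B C)) (tensor_relations B C)"

lemma tensor_free_carrier: "carrier (tensor_free B C) =
    {x. Poly_Mapping.keys x \<subseteq> carrier B \<times> carrier C}"
  by (simp add: tensor_free_def)

lemma group_tensor_free: "group (add_monoid (tensor_free B C))"
proof (rule groupI)
  fix x y z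
  assume "x \<in> carrier (add_monoid (tensor_free B C))"
  then show "\<exists>y\<in>carrier (add_monoid (tensor_free B C)).
      y \<otimes>\<^bsub>add_monoid (tensor_free B C)\<^esub> x = \<one>\<^bsub>add_monoid (tensor_free B C)\<^esub>"
    by (intro bexI[of _ "- x"]) (simp_all add: tensor_free_def)
next
  fix x y
  assume "x \<in> carrier (add_monoid (tensor_free B C))" "y \<in> carrier (add_monoid (tensor_free B C))"
  then show "x \<otimes>\<^bsub>add_monoid (tensor_free B C)\<^esub> y \<in> carrier (add_monoid (tensor_free B C))"
    using Poly_Mapping.keys_add[of x y] by (auto simp: tensor_free_def)
qed (simp_all add: tensor_free_def add.assoc)

lemma inv_tensor_free:
  assumes "x \<in> carrier (tensor_free B C)"
  shows "inv\<^bsub>add_monoid (tensor_free B C)\<^esub> x = - x"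
  by (rule group.inv_equality[OF group_tensor_free]) (use assms in \<open>auto simp: tensor_free_def\<close>)

lemma relations_closed: "tensor_relations B C \<subseteq> carrier (tensor_free B C)"
proof -
  have "x - y \<in> carrier (tensor_free B C)"
    if "x \<in> carrier (tensor_free B C)" "y \<in> carrier (tensor_free B C)" for x y
    using that keys_diff[of x y] by (auto simp: tensor_free_carrier)
  moreover have "frag_of (b, c) \<in> carrier (tensor_free B C)"
    if "b \<in> carrier B" "c \<in> carrier C" for b c
    using that by (simp add: tensor_free_carrier)
  ultimately show ?thesis
    unfolding tensor_relations_def
    by (intro Un_least subsetI; elim CollectE exE conjE)
      (simp_all add: B_add B_smult C_add C_smult)
qed

lemma null_closed: "null \<subseteq> carrier (tensor_free B C)"
  using group.generate_incl[OF group_tensor_free] relations_closed by (simp add: null_def)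

lemma null_0: "0 \<in> null"
  using generate.one[of "add_monoid (tensor_free B C)" "tensor_relations B C"]
  by (simp add: null_def tensor_free_def)

lemma null_add: "x \<in> null \<Longrightarrow> y \<in> null \<Longrightarrow> x + y \<in> null"
  using generate.eng[of x "add_monoid (tensor_free B C)" "tensor_relations B C" y]
  by (simp add: null_def tensor_free_def)

lemma null_uminus: assumes "x \<in> null" shows "- x \<in> null"
proof -
  have "inv\<^bsub>add_monoid (tensor_free B C)\<^esub> x \<in> null"
    using group.generate_m_inv_closed[OF group_tensor_free, of "tensor_relations B C" x]
      relations_closed assms by (simp add: null_def)
  then show ?thesis
    using inv_tensor_free assms null_closed by auto
qed

lemma null_diff: "x \<in> null \<Longrightarrow> y \<in> null \<Longrightarrow> x - y \<in> null"
  using null_add[of x "- y"] null_uminus[of y] by simp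

lemma null_sum: "(\<And>i. i \<in> I \<Longrightarrow> f i \<in> null) \<Longrightarrow> sum f I \<in> null"
  by (induction I rule: infinite_finite_induct) (auto intro: null_0 null_add)

lemma null_relation: "x \<in> tensor_relations B C \<Longrightarrow> x \<in> null"
  by (simp add: null_def generate.incl)

lemma null_add_left:
  "b \<in> carrier B \<Longrightarrow> b' \<in> carrier B \<Longrightarrow> c \<in> carrier C \<Longrightarrow>
    frag_of (b \<oplus>\<^bsub>B\<^esub> b', c) - frag_of (b, c) - frag_of (b', c) \<in> null"
  by (rule null_relation) (auto simp: tensor_relations_def)

lemma null_add_right:
  "b \<in> carrier B \<Longrightarrow> c \<in> carrier C \<Longrightarrow> c' \<in> carrier C \<Longrightarrow>
    frag_of (b, c \<oplus>\<^bsub>C\<^esub> c') - frag_of (b, c) - frag_of (b, c') \<in> null"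
  by (rule null_relation) (auto simp: tensor_relations_def)

lemma null_balanced:
  "b \<in> carrier B \<Longrightarrow> c \<in> carrier C \<Longrightarrow>
    frag_of (r \<odot>\<^bsub>B\<^esub> b, c) - frag_of (b, r \<odot>\<^bsub>C\<^esub> c) \<in> null"
  by (rule null_relation) (auto simp: tensor_relations_def)

text \<open>For b' = b the additivity relation collapses to minus the generator. Zero is recognised
  by b + b = b, so no group law of the factor has to be invoked.\<close>

lemma null_if_idem_left:
  assumes "b \<in> carrier B" "b \<oplus>\<^bsub>B\<^esub> b = b" "c \<in> carrier C"
  shows "frag_of (b, c) \<in> null"
  using null_uminus[OF null_add_left[OF assms(1,1,3)]] assms(2) by simp

lemma null_if_idem_right:
  assumes "b \<in> carrier B" "c \<oplus>\<^bsub>C\<^esub> c = c" "c \<in> carrier C"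
  shows "frag_of (b, c) \<in> null"
  using null_uminus[OF null_add_right[OF assms(1,3,3)]] assms(2) by simp

section \<open>Additive maps out of the tensor product\<close>

definition lin_ext :: "('b \<times> 'c \<Rightarrow> 'x::ring_1) \<Rightarrow> (('b \<times> 'c) \<Rightarrow>\<^sub>0 int) \<Rightarrow> 'x" where
  "lin_ext \<phi> x = (\<Sum>p\<in>Poly_Mapping.keys x. of_int (Poly_Mapping.lookup x p) * \<phi> p)"

lemma lin_ext_superset:
  assumes "finite S" "Poly_Mapping.keys x \<subseteq> S"
  shows "lin_ext \<phi> x = (\<Sum>p\<in>S. of_int (Poly_Mapping.lookup x p) * \<phi> p)"
  unfolding lin_ext_def using assms
  by (intro sum.mono_neutral_left) (auto simp: in_keys_iff)

lemma lin_ext_frag_of: "lin_ext \<phi> (frag_of p) = \<phi> p"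
  by (simp add: lin_ext_def)

lemma lin_ext_add: "lin_ext \<phi> (x + y) = lin_ext \<phi> x + lin_ext \<phi> y"
proof -
  let ?S = "Poly_Mapping.keys x \<union> Poly_Mapping.keys y"
  have "Poly_Mapping.keys (x + y) \<subseteq> ?S"
    by (rule Poly_Mapping.keys_add)
  then show ?thesis
    using lin_ext_superset[of ?S "x + y" \<phi>] lin_ext_superset[of ?S x \<phi>]
      lin_ext_superset[of ?S y \<phi>]
    by (simp add: lookup_add distrib_right sum.distrib)
qed

lemma lin_ext_uminus: "lin_ext \<phi> (- x) = - lin_ext \<phi> x"
  by (simp add: lin_ext_def sum_negf)

lemma lin_ext_diff: "lin_ext \<phi> (x - y) = lin_ext \<phi> x - lin_ext \<phi> y"
  using lin_ext_add[of \<phi> x "- y"] by (simp add: lin_ext_uminus)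

lemma lin_ext_sum: "lin_ext \<phi> (\<Sum>i\<in>I. f i) = (\<Sum>i\<in>I. lin_ext \<phi> (f i))"
  by (induction I rule: infinite_finite_induct)
    (auto simp: lin_ext_add, simp_all add: lin_ext_def)

text \<open>The universal property of the tensor product: a balanced biadditive map kills the
  relations and so the subgroup they generate. It serves to show that a tensor is nonzero.\<close>

lemma lin_ext_null:
  assumes "\<And>b b' c. b \<in> carrier B \<Longrightarrow> b' \<in> carrier B \<Longrightarrow> c \<in> carrier C \<Longrightarrow>
      \<phi> (b \<oplus>\<^bsub>B\<^esub> b', c) = \<phi> (b, c) + \<phi> (b', c)"
    and "\<And>b c c'. b \<in> carrier B \<Longrightarrow> c \<in> carrier C \<Longrightarrow> c' \<in> carrier C \<Longrightarrow>
      \<phi> (b, c \<oplus>\<^bsub>C\<^esub> c') = \<phi> (b, c) + \<phi> (b, c')"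
    and "\<And>r b c. b \<in> carrier B \<Longrightarrow> c \<in> carrier C \<Longrightarrow>
      \<phi> (r \<odot>\<^bsub>B\<^esub> b, c) = \<phi> (b, r \<odot>\<^bsub>C\<^esub> c)"
    and "x \<in> null"
  shows "lin_ext \<phi> x = 0"
proof -
  have rel: "lin_ext \<phi> h = 0" if "h \<in> tensor_relations B C" for h
    using that assms(1-3) unfolding tensor_relations_def
    by (auto simp: lin_ext_diff lin_ext_frag_of)
  show ?thesis
    using assms(4) unfolding null_def
  proof (induction x rule: generate.induct)
    case one
    then show ?case
      by (simp add: tensor_free_def lin_ext_def)
  next
    case (incl h)
    then show ?case
      by (rule rel)
  next
    case (inv h)
    then have "inv\<^bsub>add_monoid (tensor_free B C)\<^esub> h = - h"
      using relations_closed by (intro inv_tensor_free) blast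
    then show ?case
      by (simp add: lin_ext_uminus rel[OF inv])
  next
    case (eng h1 h2)
    then show ?case
      by (simp add: tensor_free_def lin_ext_add)
  qed
qed

lemma tensor_coset: "null +>\<^bsub>tensor_free B C\<^esub> x = {h + x | h. h \<in> null}"
  by (auto simp: a_r_coset_def' tensor_free_def)

lemma tensor_coset_eq_null_iff: "null +>\<^bsub>tensor_free B C\<^esub> x = null \<longleftrightarrow> x \<in> null"
proof
  assume "null +>\<^bsub>tensor_free B C\<^esub> x = null"
  moreover have "x \<in> null +>\<^bsub>tensor_free B C\<^esub> x"
    unfolding tensor_coset using null_0 by force
  ultimately show "x \<in> null"
    by blast
next
  assume x: "x \<in> null"
  have "y \<in> null +>\<^bsub>tensor_free B C\<^esub> x" if "y \<in> null" for y
    unfolding tensor_coset using null_diff[OF that x] by (intro CollectI exI[of _ "y - x"]) simp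
  with x show "null +>\<^bsub>tensor_free B C\<^esub> x = null"
    unfolding tensor_coset by (auto intro: null_add)
qed

text \<open>
  That \<^const>\<open>null\<close> is an ideal need not be checked: the product of two cosets is again a coset
  because the quotient is assumed to be a ring.
\<close>

lemma null_prime:
  assumes dom: "nc_domain (tensor_algebra B C)"
    and x: "x \<in> carrier (tensor_free B C)" and y: "y \<in> carrier (tensor_free B C)"
    and xy: "x \<otimes>\<^bsub>tensor_free B C\<^esub> y \<in> null"
  shows "x \<in> null \<or> y \<in> null"
proof -
  define Q where "Q = tensor_algebra B C"
  interpret Q: nc_domain Q
    using dom by (simp add: Q_def)
  let ?c = "\<lambda>x. null +>\<^bsub>tensor_free B C\<^esub> x"
  have carrier_Q: "carrier Q = ?c ` carrier (tensor_free B C)"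
    by (auto simp: Q_def tensor_algebra_def FactRing_def A_RCOSETS_def' null_def)
  have zero_Q: "\<zero>\<^bsub>Q\<^esub> = null"
    by (simp add: Q_def tensor_algebra_def FactRing_def null_def)
  have mult_Q: "u \<otimes>\<^bsub>Q\<^esub> v = (\<Union>a\<in>u. \<Union>b\<in>v. ?c (a \<otimes>\<^bsub>tensor_free B C\<^esub> b))" for u v
    by (simp add: Q_def tensor_algebra_def FactRing_def null_def rcoset_mult_def)
  have mem: "z \<in> ?c z" for z
    unfolding tensor_coset using null_0 by force
  have xQ: "?c x \<in> carrier Q" "?c y \<in> carrier Q"
    using x y by (auto simp: carrier_Q)
  then have "?c x \<otimes>\<^bsub>Q\<^esub> ?c y \<in> carrier Q"
    by simp
  then obtain z where z: "?c x \<otimes>\<^bsub>Q\<^esub> ?c y = ?c z"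
    unfolding carrier_Q by blast
  have "?c (x \<otimes>\<^bsub>tensor_free B C\<^esub> y) \<subseteq> ?c x \<otimes>\<^bsub>Q\<^esub> ?c y"
    unfolding mult_Q using mem[of x] mem[of y] by blast
  moreover have "?c (x \<otimes>\<^bsub>tensor_free B C\<^esub> y) = null"
    using xy by (simp add: tensor_coset_eq_null_iff)
  ultimately have "0 \<in> ?c z"
    using null_0 z by auto
  then obtain h where "h \<in> null" "0 = h + z"
    unfolding tensor_coset by blast
  then have "z \<in> null"
    using null_uminus by (metis add_eq_0_iff)
  then have "?c x \<otimes>\<^bsub>Q\<^esub> ?c y = \<zero>\<^bsub>Q\<^esub>"
    by (simp add: z zero_Q tensor_coset_eq_null_iff)
  then show ?thesis
    using Q.integral[OF xQ] by (simp add: zero_Q tensor_coset_eq_null_iff)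
qed

lemma one_not_null:
  assumes "nc_domain (tensor_algebra B C)"
  shows "frag_of (\<one>\<^bsub>B\<^esub>, \<one>\<^bsub>C\<^esub>) \<notin> null"
  using nc_domain.one_not_zero[OF assms] tensor_coset_eq_null_iff[of "frag_of (\<one>\<^bsub>B\<^esub>, \<one>\<^bsub>C\<^esub>)"]
  by (auto simp: tensor_algebra_def FactRing_def null_def tensor_free_def)

lemma frag_of_closed:
  "b \<in> carrier B \<Longrightarrow> c \<in> carrier C \<Longrightarrow> frag_of (b, c) \<in> carrier (tensor_free B C)"
  by (simp add: tensor_free_carrier)

lemma sum_closed:
  "(\<And>i. i \<in> I \<Longrightarrow> f i \<in> carrier (tensor_free B C)) \<Longrightarrow> sum f I \<in> carrier (tensor_free B C)"
proof (induction I rule: infinite_finite_induct)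
  case (insert i I)
  then show ?case
    using Poly_Mapping.keys_add[of "f i" "sum f I"] by (auto simp: tensor_free_carrier)
qed (simp_all add: tensor_free_carrier)

lemma tensor_mult_sum:
  assumes "finite I" "finite J"
  shows "(\<Sum>i\<in>I. frag_of (b i, c i)) \<otimes>\<^bsub>tensor_free B C\<^esub> (\<Sum>j\<in>J. frag_of (b' j, c' j)) =
    (\<Sum>i\<in>I. \<Sum>j\<in>J. frag_of (b i \<otimes>\<^bsub>B\<^esub> b' j, c i \<otimes>\<^bsub>C\<^esub> c' j))"
  using assms by (simp add: tensor_free_def frag_extend_sum o_def)

end


section \<open>The associated graded algebra\<close>

locale filtered_algebra = k_algebra scale
  for scale :: "'k::field \<Rightarrow> 'a::ring_1 \<Rightarrow> 'a" +
  fixes V :: "nat \<Rightarrow> 'a set"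
  assumes fd: "finite_dim_filtration V"
begin

lemma subspace_V: "subspace (V n)"
  and V_exhaustive: "(\<Union>n. V n) = UNIV"
  and V_mono: "n \<le> m \<Longrightarrow> V n \<subseteq> V m"
  and V_mult: "x \<in> V n \<Longrightarrow> y \<in> V m \<Longrightarrow> x * y \<in> V (n + m)"
  using fd by (auto simp: finite_dim_filtration_def filtration_def)

lemma V_finite_dim: "\<exists>S. finite S \<and> span S = V n"
  using fd by (simp add: finite_dim_filtration_def)

lemma subspace_lower: "subspace (lower V n)"
  by (simp add: lower_def subspace_V)

lemma lower_subset: "lower V n \<subseteq> V n"
  using V_mono[of "n - 1" n] subspace_0[OF subspace_V] by (auto simp: lower_def)

lemma lower_mult_V: assumes "x \<in> lower V n" "y \<in> V m" shows "x * y \<in> lower V (n + m)"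
proof (cases n)
  case 0
  with assms show ?thesis
    using subspace_0[OF subspace_lower] by (simp add: lower_def)
next
  case (Suc k)
  with assms show ?thesis
    using V_mult[of x k y m] by (simp add: lower_def)
qed

lemma V_mult_lower: assumes "x \<in> V n" "y \<in> lower V m" shows "x * y \<in> lower V (n + m)"
proof (cases m)
  case 0
  with assms show ?thesis
    using subspace_0[OF subspace_lower] by (simp add: lower_def)
next
  case (Suc k)
  with assms show ?thesis
    using V_mult[of x n y k] by (simp add: lower_def)
qed

lemma coset_eq_iff: assumes "subspace W" shows "v +o W = w +o W \<longleftrightarrow> v - w \<in> W"
proof
  assume eq: "v +o W = w +o W"
  have "v + 0 \<in> v +o W"
    using subspace_0[OF assms] by (rule set_plus_intro2)
  then show "v - w \<in> W"
    unfolding eq by (simp add: set_minus_plus)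
next
  assume vw: "v - w \<in> W"
  show "v +o W = w +o W"
  proof (intro Set.set_eqI iffI)
    fix x
    assume "x \<in> v +o W"
    then show "x \<in> w +o W"
      using subspace_add[OF assms vw, of "x - v"] by (simp flip: set_minus_plus)
  next
    fix x
    assume "x \<in> w +o W"
    then show "x \<in> v +o W"
      using subspace_diff[OF assms _ vw, of "x - w"] by (simp flip: set_minus_plus)
  qed
qed

lemma subspace_plus_self: assumes "subspace W" shows "W + W = W"
  using subspace_add[OF assms] set_zero_plus2[OF subspace_0[OF assms], of W]
  by (auto elim: set_plus_elim)

section \<open>Homogeneous elements of the graded algebra\<close>

definition homog :: "nat \<Rightarrow> 'a \<Rightarrow> nat \<Rightarrow> 'a set" where
  "homog d v = (\<lambda>n. if n = d then v +o lower V d else lower V n)"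

lemma homog_closed: assumes "v \<in> V d" shows "homog d v \<in> carrier (gr scale V)"
proof -
  have "\<exists>a\<in>V n. homog d v n = a +o lower V n" for n
    using assms subspace_0[OF subspace_V, of n]
    by (cases "n = d") (auto simp: homog_def intro: bexI[of _ 0])
  moreover have "finite {n. homog d v n \<noteq> lower V n}"
    by (rule finite_subset[of _ "{d}"]) (auto simp: homog_def)
  ultimately show ?thesis
    by (simp add: gr_def)
qed

lemma homog_add: "homog d u \<oplus>\<^bsub>gr scale V\<^esub> homog d v = homog d (u + v)"
  by (auto simp: gr_def homog_def set_plus_rearrange subspace_plus_self[OF subspace_lower] fun_eq_iff)

lemma scale_coset: assumes "subspace W" shows "scale c ` (v +o W) + W = scale c v +o W"
proof (intro Set.set_eqI iffI)
  fix x
  assume "x \<in> scale c ` (v +o W) + W"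
  then obtain w w' where "w \<in> W" "w' \<in> W" "x = scale c (v + w) + w'"
    by (auto simp: set_plus_def elt_set_plus_def)
  then have "x - scale c v = scale c w + w'" "scale c w + w' \<in> W"
    using assms by (auto simp: scale_right_distrib subspace_add subspace_scale)
  then show "x \<in> scale c v +o W"
    by (simp flip: set_minus_plus)
next
  fix x
  assume "x \<in> scale c v +o W"
  then obtain w where w: "w \<in> W" "x = scale c v + w"
    by (auto simp: elt_set_plus_def)
  moreover have "v \<in> v +o W"
    using subspace_0[OF assms] by (simp flip: set_minus_plus)
  ultimately show "x \<in> scale c ` (v +o W) + W"
    by (auto intro!: set_plus_intro)
qed

lemma homog_smult: "c \<odot>\<^bsub>gr scale V\<^esub> homog d v = homog d (scale c v)"
proof
  fix n
  show "(c \<odot>\<^bsub>gr scale V\<^esub> homog d v) n = homog d (scale c v) n"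
    using scale_coset[OF subspace_lower, of c v n] scale_coset[OF subspace_lower, of c 0 n]
    by (auto simp: gr_def homog_def)
qed

lemma sum_cosets:
  assumes "subspace W" "finite I" "I \<noteq> {}"
  shows "(\<Sum>i\<in>I. v i +o W) = (\<Sum>i\<in>I. v i) +o W"
  using assms(2,3)
  by (induction I rule: finite_ne_induct)
    (simp_all add: set_plus_rearrange subspace_plus_self[OF assms(1)])

text \<open>(u + p) (v + q) - u v = u q + p (v + q), and both terms lie in
  \<open>lower V (d + e)\<close>.\<close>

lemma coset_mult_coset:
  assumes "u \<in> V d" "v \<in> V e"
  shows "(u +o lower V d) * (v +o lower V e) + lower V (d + e) = (u * v) +o lower V (d + e)"
proof (intro Set.set_eqI iffI)
  fix x
  assume "x \<in> (u +o lower V d) * (v +o lower V e) + lower V (d + e)"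
  then obtain p q w where pqw: "p \<in> lower V d" "q \<in> lower V e" "w \<in> lower V (d + e)"
      "x = (u + p) * (v + q) + w"
    by (auto simp: set_plus_def set_times_def elt_set_plus_def)
  have "v + q \<in> V e"
    using pqw(2) assms(2) lower_subset subspace_add[OF subspace_V] by blast
  then have "u * q \<in> lower V (d + e)" "p * (v + q) \<in> lower V (d + e)"
    using V_mult_lower[OF assms(1) pqw(2)] lower_mult_V[OF pqw(1)] by blast+
  then have "u * q + p * (v + q) + w \<in> lower V (d + e)"
    using pqw(3) subspace_add[OF subspace_lower] by blast
  moreover have "x - u * v = u * q + p * (v + q) + w"
    using pqw(4) by (simp add: algebra_simps)
  ultimately show "x \<in> (u * v) +o lower V (d + e)"
    by (simp flip: set_minus_plus)
next
  fix x
  assume "x \<in> (u * v) +o lower V (d + e)"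
  then obtain w where "w \<in> lower V (d + e)" "x = u * v + w"
    by (auto simp: elt_set_plus_def)
  moreover have "u \<in> u +o lower V d" "v \<in> v +o lower V e"
    using subspace_0[OF subspace_lower] by (simp_all flip: set_minus_plus)
  ultimately show "x \<in> (u +o lower V d) * (v +o lower V e) + lower V (d + e)"
    by (auto intro!: set_plus_intro set_times_intro)
qed

lemma homog_mult:
  assumes "u \<in> V d" "v \<in> V e"
  shows "homog d u \<otimes>\<^bsub>gr scale V\<^esub> homog e v = homog (d + e) (u * v)"
proof
  fix n
  \<comment> \<open>Representatives of the summands of the convolution in degree \<open>n\<close>:
    all are 0 except possibly the one that pairs degree \<open>d\<close> with degree
    \<open>e\<close>.\<close>
  define w where "w i = (if i = d \<and> n - i = e then u * v else 0)" for i
  have "homog d u i * homog e v (n - i) + lower V n = w i +o lower V n" if "i \<le> n" for i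
  proof -
    define u' where "u' = (if i = d then u else 0)"
    define v' where "v' = (if n - i = e then v else 0)"
    have "homog d u i = u' +o lower V i" "homog e v (n - i) = v' +o lower V (n - i)"
      by (auto simp: homog_def u'_def v'_def)
    moreover have "u' \<in> V i" "v' \<in> V (n - i)"
      using assms subspace_0[OF subspace_V] by (auto simp: u'_def v'_def)
    moreover have "w i = u' * v'"
      by (simp add: w_def u'_def v'_def)
    ultimately show ?thesis
      using coset_mult_coset[of u' i v' "n - i"] that by simp
  qed
  then have "(homog d u \<otimes>\<^bsub>gr scale V\<^esub> homog e v) n = (\<Sum>i\<le>n. w i +o lower V n)"
    by (simp add: gr_def)
  also have "\<dots> = (\<Sum>i\<le>n. w i) +o lower V n"
    by (rule sum_cosets) (auto simp: subspace_lower)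
  also have "(\<Sum>i\<le>n. w i) = (if n = d + e then u * v else 0)"
  proof (cases "n = d + e")
    case True
    then have "w i = (if i = d then u * v else 0)" if "i \<le> n" for i
      using that by (auto simp: w_def)
    with True show ?thesis
      by (simp add: sum.delta)
  next
    case False
    then have "w i = 0" if "i \<le> n" for i
      using that by (auto simp: w_def)
    with False show ?thesis
      by simp
  qed
  finally show "(homog d u \<otimes>\<^bsub>gr scale V\<^esub> homog e v) n = homog (d + e) (u * v) n"
    by (simp add: homog_def)
qed

lemma homog_eq_zero: assumes "v \<in> lower V d" shows "homog d v = homog d 0"
  using assms coset_eq_iff[OF subspace_lower, of v d 0] by (simp add: homog_def fun_eq_iff)

lemma gr_carrier: "f \<in> carrier (gr scale V) \<longleftrightarrow>
    (\<forall>n. \<exists>a\<in>V n. f n = a +o lower V n) \<and> finite {n. f n \<noteq> lower V n}"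
  by (simp add: gr_def)

lemma gr_add_closed:
  assumes f: "f \<in> carrier (gr scale V)" and g: "g \<in> carrier (gr scale V)"
  shows "f \<oplus>\<^bsub>gr scale V\<^esub> g \<in> carrier (gr scale V)"
proof -
  have "\<exists>a\<in>V n. f n + g n = a +o lower V n" for n
  proof -
    obtain a b where "a \<in> V n" "f n = a +o lower V n" "b \<in> V n" "g n = b +o lower V n"
      using f g unfolding gr_carrier by blast
    then show ?thesis
      by (intro bexI[of _ "a + b"])
        (simp_all add: set_plus_rearrange subspace_plus_self subspace_lower subspace_add subspace_V)
  qed
  moreover have "finite {n. f n + g n \<noteq> lower V n}"
  proof (rule finite_subset)
    show "{n. f n + g n \<noteq> lower V n} \<subseteq> {n. f n \<noteq> lower V n} \<union> {n. g n \<noteq> lower V n}"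
      by (auto simp: subspace_plus_self subspace_lower)
  qed (use f g in \<open>simp add: gr_carrier\<close>)
  ultimately show ?thesis
    by (simp add: gr_def)
qed

lemma gr_smult_closed:
  assumes f: "f \<in> carrier (gr scale V)"
  shows "c \<odot>\<^bsub>gr scale V\<^esub> f \<in> carrier (gr scale V)"
proof -
  have "\<exists>a\<in>V n. scale c ` f n + lower V n = a +o lower V n" for n
  proof -
    obtain a where "a \<in> V n" "f n = a +o lower V n"
      using f unfolding gr_carrier by blast
    then show ?thesis
      by (intro bexI[of _ "scale c a"])
        (simp_all add: scale_coset subspace_lower subspace_scale subspace_V)
  qed
  moreover have "finite {n. scale c ` f n + lower V n \<noteq> lower V n}"
  proof (rule finite_subset)
    show "{n. scale c ` f n + lower V n \<noteq> lower V n} \<subseteq> {n. f n \<noteq> lower V n}"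
      using scale_coset[OF subspace_lower, of c 0] by auto
  qed (use f in \<open>simp add: gr_carrier\<close>)
  ultimately show ?thesis
    by (simp add: gr_def)
qed

sublocale tensor: tensor_factors "gr scale V"
  "alg_closure_algebra :: ('k, 'k alg_closure) module"
  by unfold_locales (simp_all add: gr_add_closed gr_smult_closed alg_closure_algebra_def)

lemma alg_closure_simps:
  "carrier (alg_closure_algebra :: ('k, 'k alg_closure) module) = UNIV"
  "x \<oplus>\<^bsub>alg_closure_algebra :: ('k, 'k alg_closure) module\<^esub> y = x + y"
  "x \<otimes>\<^bsub>alg_closure_algebra :: ('k, 'k alg_closure) module\<^esub> y = x * y"
  "r \<odot>\<^bsub>alg_closure_algebra :: ('k, 'k alg_closure) module\<^esub> y = to_ac r * y"
  by (simp_all add: alg_closure_algebra_def)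

lemma null_homog_lower: "v \<in> lower V d \<Longrightarrow> frag_of (homog d v, \<gamma>) \<in> tensor.null"
  using homog_eq_zero[of v d]
  by (simp add: tensor.null_if_idem_left homog_closed homog_add subspace_0 subspace_V
      alg_closure_simps)

text \<open>Together with \<open>null_collect_right\<close> this brings a homogeneous tensor to
  normal form, with one scalar of the algebraic closure per basis element.\<close>

lemma null_expand_left:
  assumes "\<And>g. g \<in> S \<Longrightarrow> g \<in> V n"
  shows "frag_of (homog n (\<Sum>g\<in>S. scale (r g) g), \<gamma>) -
    (\<Sum>g\<in>S. frag_of (homog n g, to_ac (r g) * \<gamma>)) \<in> tensor.null"
  using assms
proof (induction S rule: infinite_finite_induct)
  case (insert x S)
  let ?s = "\<Sum>g\<in>S. scale (r g) g"
  have V: "scale (r x) x \<in> V n" "?s \<in> V n"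
    using insert.prems by (auto intro!: subspace_sum subspace_scale subspace_V)
  have "frag_of (homog n (scale (r x) x + ?s), \<gamma>) - frag_of (homog n (scale (r x) x), \<gamma>)
      - frag_of (homog n ?s, \<gamma>) \<in> tensor.null"
    using tensor.null_add_left[OF homog_closed[OF V(1)] homog_closed[OF V(2)], of \<gamma>]
    by (simp add: homog_add alg_closure_simps)
  moreover have "frag_of (homog n (scale (r x) x), \<gamma>) - frag_of (homog n x, to_ac (r x) * \<gamma>)
      \<in> tensor.null"
    using tensor.null_balanced[OF homog_closed[of x n], of \<gamma> "r x"] insert.prems
    by (simp add: homog_smult alg_closure_simps)
  moreover have "frag_of (homog n ?s, \<gamma>) - (\<Sum>g\<in>S. frag_of (homog n g, to_ac (r g) * \<gamma>))
      \<in> tensor.null"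
    using insert by simp
  ultimately have "(frag_of (homog n (scale (r x) x + ?s), \<gamma>)
        - frag_of (homog n (scale (r x) x), \<gamma>) - frag_of (homog n ?s, \<gamma>))
      + (frag_of (homog n (scale (r x) x), \<gamma>) - frag_of (homog n x, to_ac (r x) * \<gamma>))
      + (frag_of (homog n ?s, \<gamma>) - (\<Sum>g\<in>S. frag_of (homog n g, to_ac (r g) * \<gamma>)))
      \<in> tensor.null"
    by (intro tensor.null_add)
  then show ?case
    using insert.hyps by (simp add: algebra_simps)
qed (auto simp: null_homog_lower subspace_0 subspace_lower)

lemma null_collect_right:
  assumes "v \<in> V n"
  shows "(\<Sum>i\<in>I. frag_of (homog n v, \<gamma> i)) - frag_of (homog n v, \<Sum>i\<in>I. \<gamma> i) \<in> tensor.null"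
proof (induction I rule: infinite_finite_induct)
  case (insert i I)
  have "frag_of (homog n v, \<gamma> i + sum \<gamma> I) - frag_of (homog n v, \<gamma> i) - frag_of (homog n v, sum \<gamma> I)
      \<in> tensor.null"
    using tensor.null_add_right[OF homog_closed[OF assms], of "\<gamma> i" "sum \<gamma> I"]
    by (simp add: alg_closure_simps)
  from tensor.null_diff[OF insert.IH this] insert.hyps show ?case
    by (simp add: algebra_simps)
next
  \<comment> \<open>The pair \<open>(homog n v, 0)\<close> is a nonzero generator of the free group,
    so even the empty sum requires a relation.\<close>
  case empty
  have "frag_of (homog n v, 0) \<in> tensor.null"
    by (rule tensor.null_if_idem_right) (simp_all add: homog_closed assms alg_closure_simps)
  then show ?case
    using tensor.null_uminus by fastforce
next
  case (infinite I)
  have "frag_of (homog n v, 0) \<in> tensor.null"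
    by (rule tensor.null_if_idem_right) (simp_all add: homog_closed assms alg_closure_simps)
  then show ?case
    using tensor.null_uminus infinite by fastforce
qed

end


section \<open>A basis adapted to the filtration\<close>

context filtered_algebra
begin

text \<open>A basis of each \<open>V n\<close> is extended to one of \<open>V (Suc n)\<close>; the
  union of this chain stays independent. Adaptedness makes coordinates respect the filtration: an
  element of \<open>V n\<close> involves only basis elements in \<open>V n\<close>.\<close>

lemma adapted_basis_exists:
  "\<exists>Bas. independent Bas \<and> (\<forall>n. span (Bas \<inter> V n) = V n)"
proof -
  have "\<exists>F. \<forall>n. (independent (F n) \<and> F n \<subseteq> V n \<and> V n \<subseteq> span (F n)) \<and> F n \<subseteq> F (Suc n)"
  proof (rule dependent_nat_choice[of "\<lambda>n x. independent x \<and> x \<subseteq> V n \<and> V n \<subseteq> span x" "\<lambda>n x y. x \<subseteq> y"])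
    obtain x where "x \<subseteq> V 0" "independent x" "V 0 \<subseteq> span x"
      by (rule maximal_independent_subset)
    then show "\<exists>x. independent x \<and> x \<subseteq> V 0 \<and> V 0 \<subseteq> span x"
      by blast
    fix x n
    assume x: "independent x \<and> x \<subseteq> V n \<and> V n \<subseteq> span x"
    then have "x \<subseteq> V (Suc n)" "independent x"
      using V_mono[of n "Suc n"] by auto
    then obtain y where "x \<subseteq> y" "y \<subseteq> V (Suc n)" "independent y" "V (Suc n) \<subseteq> span y"
      by (rule maximal_independent_subset_extend)
    then show "\<exists>y. (independent y \<and> y \<subseteq> V (Suc n) \<and> V (Suc n) \<subseteq> span y) \<and> x \<subseteq> y"
      by blast
  qed
  then obtain F where F: "\<And>n. independent (F n)" "\<And>n. F n \<subseteq> V n" "\<And>n. V n \<subseteq> span (F n)"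
    and "\<And>n. F n \<subseteq> F (Suc n)"
    by blast
  then have F_mono: "F m \<subseteq> F n" if "m \<le> n" for m n
    using lift_Suc_mono_le[of F, OF _ that] by blast
  have "independent (\<Union> (range F))"
  proof (rule independent_Union_directed)
    fix c d
    assume "c \<in> range F" "d \<in> range F"
    then show "c \<subseteq> d \<or> d \<subseteq> c"
      using F_mono by (metis imageE nle_le)
  qed (use F in auto)
  moreover have "span (\<Union> (range F) \<inter> V n) = V n" for n
  proof
    show "span (\<Union> (range F) \<inter> V n) \<subseteq> V n"
      by (rule span_minimal) (auto simp: subspace_V)
    have "F n \<subseteq> \<Union> (range F) \<inter> V n"
      using F(2) by blast
    with F(3)[of n] show "V n \<subseteq> span (\<Union> (range F) \<inter> V n)"
      using span_mono by blast
  qed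
  ultimately show ?thesis
    by blast
qed

definition Bas :: "'a set" where
  "Bas = (SOME Bas. independent Bas \<and> (\<forall>n. span (Bas \<inter> V n) = V n))"

lemma independent_Bas: "independent Bas" and span_Bas_V: "span (Bas \<inter> V n) = V n"
  using someI_ex[OF adapted_basis_exists] by (simp_all add: Bas_def)

lemma span_Bas: "span Bas = UNIV"
proof -
  have "V n \<subseteq> span Bas" for n
    using span_mono[of "Bas \<inter> V n" Bas] by (simp add: span_Bas_V)
  then show ?thesis
    using V_exhaustive by blast
qed

lemma finite_Bas_V: "finite (Bas \<inter> V n)"
proof -
  obtain S where S: "finite S" "span S = V n"
    using V_finite_dim by blast
  have "independent (Bas \<inter> V n)"
    using independent_Bas by (rule independent_mono) simp
  then show ?thesis
    using independent_span_bound[OF S(1)] S(2) by auto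
qed

abbreviation rep :: "'a \<Rightarrow> 'a \<Rightarrow> 'k" where
  "rep \<equiv> representation Bas"

lemma rep_add: "rep (u + v) g = rep u g + rep v g"
  using representation_add[OF independent_Bas] by (simp add: span_Bas)

lemma rep_diff: "rep (u - v) g = rep u g - rep v g"
  using representation_diff[OF independent_Bas] by (simp add: span_Bas)

lemma rep_scale: "rep (scale c v) g = c * rep v g"
  using representation_scale[OF independent_Bas] by (simp add: span_Bas)

lemma rep_sum: "rep (sum f I) g = (\<Sum>i\<in>I. rep (f i) g)"
  using representation_sum[OF independent_Bas, of I f] by (simp add: span_Bas)

lemma rep_basis: "b \<in> Bas \<Longrightarrow> rep b g = (if g = b then 1 else 0)"
  by (simp add: representation_basis[OF independent_Bas])

lemma rep_restrict: assumes "v \<in> V n" shows "rep v = representation (Bas \<inter> V n) v"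
  by (rule representation_extend[OF independent_Bas]) (simp_all add: span_Bas_V assms)

lemma rep_in_V: "v \<in> V n \<Longrightarrow> rep v g \<noteq> 0 \<Longrightarrow> g \<in> Bas \<inter> V n"
  using representation_ne_zero[of "Bas \<inter> V n" v g] by (simp add: rep_restrict)

lemma rep_in_lower: "v \<in> lower V n \<Longrightarrow> rep v g \<noteq> 0 \<Longrightarrow> g \<in> lower V n"
  using rep_in_V[of v "n - 1" g] by (auto simp: lower_def representation_zero split: if_splits)

lemma sum_rep: assumes "v \<in> V n" shows "(\<Sum>g\<in>Bas \<inter> V n. scale (rep v g) g) = v"
  unfolding rep_restrict[OF assms]
  using independent_mono[OF independent_Bas, of "Bas \<inter> V n"]
  by (intro sum_representation_eq) (simp_all add: span_Bas_V assms finite_Bas_V)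

text \<open>The basis elements that enter at step \<open>n\<close>; their cosets form a basis of the
  graded piece V_n / V_{n-1}.\<close>

definition exact_Bas :: "nat \<Rightarrow> 'a set" where
  "exact_Bas n = {b \<in> Bas. b \<in> V n \<and> b \<notin> lower V n}"

lemma finite_exact_Bas: "finite (exact_Bas n)"
  by (rule finite_subset[OF _ finite_Bas_V[of n]]) (auto simp: exact_Bas_def)

text \<open>Any representative of the coset will do when \<open>b\<close> is in
  \<open>exact_Bas d\<close>: two of them differ by an element of \<open>lower V d\<close>, whose
  coordinate at \<open>b\<close> is 0.\<close>

definition coord :: "nat \<Rightarrow> 'a \<Rightarrow> (nat \<Rightarrow> 'a set) \<Rightarrow> 'k" where
  "coord d b f = rep (SOME v. v \<in> f d) b"

lemma coord_eq:
  assumes "b \<in> exact_Bas d" "f d = v +o lower V d"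
  shows "coord d b f = rep v b"
proof -
  have "v + 0 \<in> f d"
    unfolding assms(2) using subspace_0[OF subspace_lower] by (rule set_plus_intro2)
  then have "(SOME v. v \<in> f d) \<in> f d"
    by (rule someI)
  then have "(SOME v. v \<in> f d) - v \<in> lower V d"
    unfolding assms(2) by (simp add: set_minus_plus)
  then have "rep ((SOME v. v \<in> f d) - v) b = 0"
    using rep_in_lower assms(1) by (auto simp: exact_Bas_def)
  then show ?thesis
    by (simp add: coord_def rep_diff)
qed

text \<open>The map (f, c) \<mapsto> coord d b f * c is biadditive and balanced, so it vanishes on
  \<open>null\<close>, and on the given sum it returns \<alpha> b.\<close>

lemma null_homog_sum_imp:
  assumes "(\<Sum>b\<in>exact_Bas d. frag_of (homog d b, \<alpha> b)) \<in> tensor.null" "b \<in> exact_Bas d"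
  shows "\<alpha> b = 0"
proof -
  define \<phi> where "\<phi> = (\<lambda>(f, c). to_ac (coord d b f) * c)"
  have coset: "\<exists>v. f d = v +o lower V d" if "f \<in> carrier (gr scale V)" for f
    using that by (auto simp: gr_carrier)
  have "tensor.lin_ext \<phi> (\<Sum>b\<in>exact_Bas d. frag_of (homog d b, \<alpha> b)) = 0"
  proof (rule tensor.lin_ext_null)
    fix f f' and c :: "'k alg_closure"
    assume f: "f \<in> carrier (gr scale V)" "f' \<in> carrier (gr scale V)"
    obtain v v' where v: "f d = v +o lower V d" "f' d = v' +o lower V d"
      using coset[OF f(1)] coset[OF f(2)] by auto
    then have "(f \<oplus>\<^bsub>gr scale V\<^esub> f') d = (v + v') +o lower V d"
      by (simp add: gr_def set_plus_rearrange subspace_plus_self[OF subspace_lower])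
    with v show "\<phi> (f \<oplus>\<^bsub>gr scale V\<^esub> f', c) = \<phi> (f, c) + \<phi> (f', c)"
      using assms(2) by (simp add: \<phi>_def coord_eq rep_add distrib_right)
  next
    fix f r and c :: "'k alg_closure"
    assume f: "f \<in> carrier (gr scale V)"
    obtain v where v: "f d = v +o lower V d"
      using coset[OF f] by auto
    then have "(r \<odot>\<^bsub>gr scale V\<^esub> f) d = scale r v +o lower V d"
      by (simp add: gr_def scale_coset[OF subspace_lower])
    with v show "\<phi> (r \<odot>\<^bsub>gr scale V\<^esub> f, c) = \<phi> (f, r \<odot>\<^bsub>alg_closure_algebra\<^esub> c)"
      using assms(2) by (simp add: \<phi>_def coord_eq rep_scale alg_closure_simps mult_ac)
  qed (use assms(1) in \<open>simp_all add: \<phi>_def alg_closure_simps distrib_left\<close>)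
  also have "tensor.lin_ext \<phi> (\<Sum>b\<in>exact_Bas d. frag_of (homog d b, \<alpha> b)) =
      (\<Sum>b'\<in>exact_Bas d. to_ac (rep b' b) * \<alpha> b')"
    using assms(2)
    by (auto simp: tensor.lin_ext_sum tensor.lin_ext_frag_of \<phi>_def coord_eq homog_def intro!: sum.cong)
  also have "\<dots> = (\<Sum>b'\<in>exact_Bas d. if b' = b then \<alpha> b' else 0)"
    by (intro sum.cong) (auto simp: exact_Bas_def rep_basis)
  also have "\<dots> = \<alpha> b"
    using assms(2) finite_exact_Bas by simp
  finally show ?thesis .
qed

end


section \<open>Leading forms and the absence of zero divisors\<close>

locale geometrically_integral_gr = filtered_algebra scale V
  for scale :: "'k::field \<Rightarrow> 'a::ring_1 \<Rightarrow> 'a" and V +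
  assumes dom: "nc_domain (tensor_algebra (gr scale V)
    (alg_closure_algebra :: ('k, 'k alg_closure) module))"
begin

text \<open>For \<open>g\<close> of exact degree d + e the scalars \<open>rep (b * c) g\<close> are
  the structure constants of the graded algebra. If all sums vanished, the product of the tensors
  \<open>x\<close> and \<open>y\<close> would be null, hence one of them would be, against the
  independence in \<open>null_homog_sum_imp\<close>.\<close>

lemma graded_product_nonzero:
  assumes "b0 \<in> exact_Bas d" "\<alpha> b0 \<noteq> 0" "c0 \<in> exact_Bas e" "\<beta> c0 \<noteq> 0"
  shows "\<exists>g\<in>exact_Bas (d + e).
    (\<Sum>b\<in>exact_Bas d. \<Sum>c\<in>exact_Bas e. \<alpha> b * \<beta> c * to_ac (rep (b * c) g)) \<noteq> 0"
proof (rule ccontr)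
  assume neg: "\<not> ?thesis"
  let ?T = "tensor_free (gr scale V) (alg_closure_algebra :: ('k, 'k alg_closure) module)"
  let ?P = "exact_Bas d \<times> exact_Bas e"
  let ?W = "Bas \<inter> V (d + e)"
  let ?h = "homog (d + e)"
  let ?t = "\<lambda>(b, c). \<alpha> b * \<beta> c"
  let ?r = "\<lambda>(b, c) g. to_ac (rep (b * c) g)"
  define x where "x = (\<Sum>b\<in>exact_Bas d. frag_of (homog d b, \<alpha> b))"
  define y where "y = (\<Sum>c\<in>exact_Bas e. frag_of (homog e c, \<beta> c))"
  define z where "z = (\<Sum>p\<in>?P. frag_of (?h (fst p * snd p), ?t p))"
  have V: "b \<in> exact_Bas n \<Longrightarrow> b \<in> V n" for b n
    by (simp add: exact_Bas_def)
  have xy: "x \<otimes>\<^bsub>?T\<^esub> y = z"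
    unfolding x_def y_def z_def tensor.tensor_mult_sum[OF finite_exact_Bas finite_exact_Bas]
      sum.cartesian_product
    by (intro sum.cong) (auto simp: homog_mult V alg_closure_simps)
  have "z - (\<Sum>p\<in>?P. \<Sum>g\<in>?W. frag_of (?h g, ?r p g * ?t p)) \<in> tensor.null"
    unfolding z_def sum_subtractf[symmetric]
  proof (rule tensor.null_sum)
    fix p
    assume "p \<in> ?P"
    then have "fst p * snd p \<in> V (d + e)"
      using V_mult[OF V V, of "fst p" d "snd p" e] by auto
    from null_expand_left[of ?W "d + e" "rep (fst p * snd p)" "?t p"] sum_rep[OF this]
    show "frag_of (?h (fst p * snd p), ?t p) - (\<Sum>g\<in>?W. frag_of (?h g, ?r p g * ?t p))
        \<in> tensor.null"
      by (simp add: case_prod_beta)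
  qed
  \<comment> \<open>Collected by \<open>g\<close>: if \<open>g\<close> is in the lower part its
    homogeneous element is zero, otherwise the total scalar is zero by \<open>neg\<close>.\<close>
  moreover have "(\<Sum>p\<in>?P. \<Sum>g\<in>?W. frag_of (?h g, ?r p g * ?t p)) \<in> tensor.null"
  proof (subst sum.swap, rule tensor.null_sum)
    fix g
    assume g: "g \<in> ?W"
    let ?s = "\<Sum>p\<in>?P. ?r p g * ?t p"
    have "frag_of (?h g, ?s) \<in> tensor.null"
    proof (cases "g \<in> lower V (d + e)")
      case False
      with g have "g \<in> exact_Bas (d + e)"
        by (simp add: exact_Bas_def)
      with neg have "(\<Sum>b\<in>exact_Bas d. \<Sum>c\<in>exact_Bas e. \<alpha> b * \<beta> c * to_ac (rep (b * c) g)) = 0"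
        by blast
      then have "?s = 0"
        by (simp add: sum.cartesian_product case_prod_beta mult_ac)
      then show ?thesis
        using g by (intro tensor.null_if_idem_right) (simp_all add: homog_closed alg_closure_simps)
    qed (rule null_homog_lower)
    from tensor.null_add[OF null_collect_right[of g "d + e" "\<lambda>p. ?r p g * ?t p" ?P] this] g
    show "(\<Sum>p\<in>?P. frag_of (?h g, ?r p g * ?t p)) \<in> tensor.null"
      by simp
  qed
  ultimately have "z \<in> tensor.null"
    using tensor.null_add by fastforce
  moreover have "x \<in> carrier ?T" "y \<in> carrier ?T"
    unfolding x_def y_def
    by (auto intro!: tensor.sum_closed tensor.frag_of_closed homog_closed V simp: alg_closure_simps)
  ultimately have "x \<in> tensor.null \<or> y \<in> tensor.null"
    using tensor.null_prime[OF dom] xy by metis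
  then show False
    using null_homog_sum_imp[of d \<alpha> b0] null_homog_sum_imp[of e \<beta> c0] assms
    by (auto simp: x_def y_def)
qed

lemma one_neq_zero: "(1::'a) \<noteq> 0"
proof
  assume "(1::'a) = 0"
  then have "\<one>\<^bsub>gr scale V\<^esub> = homog 0 0"
    by (simp add: gr_def homog_def)
  then have "frag_of (\<one>\<^bsub>gr scale V\<^esub>, \<one>\<^bsub>alg_closure_algebra :: ('k, 'k alg_closure) module\<^esub>)
      \<in> tensor.null"
    by (simp add: null_homog_lower subspace_0 subspace_lower)
  then show False
    using tensor.one_not_null[OF dom] by blast
qed

section \<open>The degree and its additivity\<close>

definition deg :: "'a \<Rightarrow> nat" where
  "deg v = (LEAST n. v \<in> V n)"

lemma in_V_deg: "v \<in> V (deg v)"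
proof -
  have "\<exists>n. v \<in> V n"
    using V_exhaustive by blast
  then show ?thesis
    unfolding deg_def by (rule LeastI_ex)
qed

lemma deg_le: "v \<in> V n \<Longrightarrow> deg v \<le> n"
  unfolding deg_def by (rule Least_le)

lemma in_V_iff: "v \<in> V n \<longleftrightarrow> deg v \<le> n"
  using in_V_deg V_mono deg_le by blast

text \<open>\<open>lower V 0\<close> contains 0 although no degree is below 0, hence the separate
  case.\<close>

lemma in_lower_iff: "v \<in> lower V n \<longleftrightarrow> v = 0 \<or> deg v < n"
  using deg_le[OF subspace_0[OF subspace_V, of 0]]
  by (cases n) (auto simp: lower_def in_V_iff)

lemma deg_scale: "c \<noteq> 0 \<Longrightarrow> deg (scale c v) = deg v"
proof (rule antisym)
  show "deg (scale c v) \<le> deg v" for c v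
    by (intro deg_le subspace_scale subspace_V in_V_deg)
  from this[of "inverse c" "scale c v"] show "deg v \<le> deg (scale c v)" if "c \<noteq> 0"
    using that by simp
qed

lemma in_exact_Bas_iff: "b \<in> exact_Bas n \<longleftrightarrow> b \<in> Bas \<and> deg b = n"
  using dependent_zero[of Bas] independent_Bas
  by (auto simp: exact_Bas_def in_V_iff in_lower_iff)

text \<open>Modulo \<open>lower V (deg u + deg v)\<close> both factors may be replaced by their
  leading parts \<open>top u\<close> and \<open>top v\<close>, whose product has a nonzero
  coordinate at some basis element of exact degree.\<close>

lemma mult_not_in_lower:
  assumes "u \<noteq> 0" "v \<noteq> 0"
  shows "u * v \<notin> lower V (deg u + deg v)"
proof
  assume uv: "u * v \<in> lower V (deg u + deg v)"
  define top where "top w = (\<Sum>b\<in>exact_Bas (deg w). scale (rep w b) b)" for w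
  have diff: "w - top w \<in> lower V (deg w)" for w
  proof -
    have "w = (\<Sum>b\<in>Bas \<inter> V (deg w). scale (rep w b) b)"
      using sum_rep[OF in_V_deg, of w] by simp
    also have "\<dots> = (\<Sum>b\<in>exact_Bas (deg w). scale (rep w b) b) +
        (\<Sum>b\<in>Bas \<inter> V (deg w) - exact_Bas (deg w). scale (rep w b) b)"
      by (subst add.commute, rule sum.subset_diff) (auto simp: exact_Bas_def finite_Bas_V)
    finally have "w - top w = (\<Sum>b\<in>Bas \<inter> V (deg w) - exact_Bas (deg w). scale (rep w b) b)"
      by (simp add: top_def algebra_simps)
    also have "\<dots> \<in> lower V (deg w)"
      by (intro subspace_sum subspace_scale subspace_lower) (auto simp: exact_Bas_def)
    finally show ?thesis .
  qed
  have top_V: "top w \<in> V (deg w)" for w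
    unfolding top_def by (intro subspace_sum subspace_scale subspace_V) (simp add: exact_Bas_def)
  have coeff: "\<exists>b\<in>exact_Bas (deg w). to_ac (rep w b) \<noteq> 0" if "w \<noteq> 0" for w
  proof (rule ccontr)
    assume "\<not> ?thesis"
    then have "top w = 0"
      by (simp add: top_def)
    with diff[of w] that show False
      by (simp add: in_lower_iff)
  qed
  obtain g where g: "g \<in> exact_Bas (deg u + deg v)"
    and ne: "(\<Sum>b\<in>exact_Bas (deg u). \<Sum>c\<in>exact_Bas (deg v).
      to_ac (rep u b) * to_ac (rep v c) * to_ac (rep (b * c) g)) \<noteq> 0"
    using graded_product_nonzero[of _ "deg u" "\<lambda>b. to_ac (rep u b)" _ "deg v" "\<lambda>c. to_ac (rep v c)"]
      coeff[OF assms(1)] coeff[OF assms(2)] by blast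
  have "rep (top u * top v) g = (\<Sum>b\<in>exact_Bas (deg u). \<Sum>c\<in>exact_Bas (deg v).
      rep u b * rep v c * rep (b * c) g)"
    unfolding top_def sum_product rep_sum
    by (simp add: scale_mult_left scale_mult_right rep_scale mult_ac)
  then have "to_ac (rep (top u * top v) g) \<noteq> 0"
    using ne by (simp add: to_ac_sum)
  moreover have "top u * top v \<in> lower V (deg u + deg v)"
  proof -
    have "(u - top u) * v \<in> lower V (deg u + deg v)" "top u * (v - top v) \<in> lower V (deg u + deg v)"
      by (rule lower_mult_V[OF diff in_V_deg], rule V_mult_lower[OF top_V diff])
    then have "u * v - (u - top u) * v - top u * (v - top v) \<in> lower V (deg u + deg v)"
      using uv by (intro subspace_diff[OF subspace_lower])
    then show ?thesis
      by (simp add: algebra_simps)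
  qed
  ultimately show False
    using rep_in_lower[of "top u * top v" _ g] g by (auto simp: exact_Bas_def)
qed

lemma mult_nonzero: "(u::'a) \<noteq> 0 \<Longrightarrow> v \<noteq> 0 \<Longrightarrow> u * v \<noteq> 0"
  using mult_not_in_lower[of u v] by (auto simp: in_lower_iff)

lemma deg_mult: assumes "u \<noteq> 0" "v \<noteq> 0" shows "deg (u * v) = deg u + deg v"
proof (rule antisym)
  show "deg (u * v) \<le> deg u + deg v"
    by (intro deg_le V_mult in_V_deg)
  show "deg u + deg v \<le> deg (u * v)"
    using mult_not_in_lower[OF assms] by (simp add: in_lower_iff not_less)
qed

text \<open>This is the absence of zero divisors in A \<otimes> K, expressed in coordinates so that
  the algebra need not be formed. Only the top degrees \<open>d\<close> and \<open>e\<close> of the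
  two supports contribute to a coordinate \<open>g\<close> of degree d + e.\<close>

lemma bilinear_nonzero:
  fixes \<alpha> \<beta> :: "'a \<Rightarrow> 'k alg_closure"
  assumes "\<exists>s\<in>Bas \<inter> V N. \<alpha> s \<noteq> 0" "\<exists>t\<in>Bas \<inter> V N. \<beta> t \<noteq> 0"
  shows "\<exists>g. (\<Sum>s\<in>Bas \<inter> V N. \<Sum>t\<in>Bas \<inter> V N. \<alpha> s * \<beta> t * to_ac (rep (s * t) g)) \<noteq> 0"
proof -
  let ?S = "Bas \<inter> V N"
  have top: "\<exists>s0\<in>?S. \<gamma> s0 \<noteq> 0 \<and> (\<forall>s\<in>?S. \<gamma> s \<noteq> 0 \<longrightarrow> deg s \<le> deg s0)"
    if "\<exists>s\<in>?S. \<gamma> s \<noteq> 0" for \<gamma> :: "'a \<Rightarrow> 'k alg_closure"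
  proof -
    let ?D = "deg ` {s \<in> ?S. \<gamma> s \<noteq> 0}"
    have "finite {s \<in> ?S. \<gamma> s \<noteq> 0}"
      using finite_Bas_V by (rule rev_finite_subset) blast
    then have "finite ?D" "?D \<noteq> {}"
      using that by auto
    then have "Max ?D \<in> ?D"
      by (rule Max_in)
    then obtain s0 where "s0 \<in> ?S" "\<gamma> s0 \<noteq> 0" "Max ?D = deg s0"
      by blast
    moreover have "deg s \<le> Max ?D" if "s \<in> ?S" "\<gamma> s \<noteq> 0" for s
      using \<open>finite ?D\<close> that by (intro Max_ge) auto
    ultimately show ?thesis
      by auto
  qed
  obtain s0 where s0: "s0 \<in> ?S" "\<alpha> s0 \<noteq> 0" "\<And>s. s \<in> ?S \<Longrightarrow> \<alpha> s \<noteq> 0 \<Longrightarrow> deg s \<le> deg s0"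
    using top[OF assms(1)] by blast
  obtain t0 where t0: "t0 \<in> ?S" "\<beta> t0 \<noteq> 0" "\<And>t. t \<in> ?S \<Longrightarrow> \<beta> t \<noteq> 0 \<Longrightarrow> deg t \<le> deg t0"
    using top[OF assms(2)] by blast
  define d e where "d = deg s0" and "e = deg t0"
  have "s0 \<in> exact_Bas d" "t0 \<in> exact_Bas e"
    using s0 t0 by (auto simp: in_exact_Bas_iff d_def e_def)
  then obtain g where g: "g \<in> exact_Bas (d + e)"
    and ne: "(\<Sum>b\<in>exact_Bas d. \<Sum>c\<in>exact_Bas e. \<alpha> b * \<beta> c * to_ac (rep (b * c) g)) \<noteq> 0"
    using graded_product_nonzero[of s0 d \<alpha> t0 e \<beta>] s0(2) t0(2) by blast
  have sub: "exact_Bas d \<times> exact_Bas e \<subseteq> ?S \<times> ?S"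
    using s0(1) t0(1) by (auto simp: in_exact_Bas_iff in_V_iff d_def e_def)
  \<comment> \<open>Either a coefficient is zero, because its degree exceeds the top one, or s * t
    has degree below d + e and cannot involve \<open>g\<close>.\<close>
  have vanish: "\<alpha> s * \<beta> t * to_ac (rep (s * t) g) = 0"
    if st: "s \<in> ?S" "t \<in> ?S" "s \<notin> exact_Bas d \<or> t \<notin> exact_Bas e" for s t
  proof (rule ccontr)
    assume nz: "\<alpha> s * \<beta> t * to_ac (rep (s * t) g) \<noteq> 0"
    then have "deg s \<le> d" "deg t \<le> e" "rep (s * t) g \<noteq> 0"
      using s0(3) t0(3) st by (auto simp: d_def e_def)
    moreover have "deg s \<noteq> d \<or> deg t \<noteq> e"
      using st by (auto simp: in_exact_Bas_iff)
    ultimately have "deg s + deg t < d + e"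
      by linarith
    then have "deg (s * t) < d + e"
      using deg_le[OF V_mult[OF in_V_deg in_V_deg], of s t] by linarith
    then have "s * t \<in> lower V (d + e)"
      by (simp add: in_lower_iff)
    with \<open>rep (s * t) g \<noteq> 0\<close> have "g \<in> lower V (d + e)"
      by (rule rep_in_lower[rotated])
    with g show False
      by (simp add: exact_Bas_def)
  qed
  have "(\<Sum>s\<in>?S. \<Sum>t\<in>?S. \<alpha> s * \<beta> t * to_ac (rep (s * t) g)) =
      (\<Sum>b\<in>exact_Bas d. \<Sum>c\<in>exact_Bas e. \<alpha> b * \<beta> c * to_ac (rep (b * c) g))"
    unfolding sum.cartesian_product
    by (rule sum.mono_neutral_right) (use sub vanish finite_Bas_V in \<open>auto simp del: mult_eq_0_iff\<close>)
  with ne show ?thesis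
    by metis
qed

text \<open>A factorization yields the rank one matrix of products of coordinates. Each entry has
  finitely many possible values, and the matrix determines the left factor up to a scalar.\<close>

lemma finite_left_factors:
  assumes a: "a \<noteq> 0"
  shows "\<exists>L. finite L \<and> (\<forall>b c. b * c = a \<longrightarrow> (\<exists>l\<in>L. \<exists>\<kappa>. \<kappa> \<noteq> 0 \<and> b = scale \<kappa> l))"
proof -
  define S where "S = Bas \<inter> V (deg a)"
  define T where "T = (\<lambda>(i, j). {\<alpha> i * \<beta> j | \<alpha> \<beta>. \<forall>g.
      (\<Sum>s\<in>S. \<Sum>t\<in>S. \<alpha> s * \<beta> t * to_ac (rep (s * t) g)) = to_ac (rep a g)})"
  define F where "F = {(b, c). b * c = a}"
  define \<tau> where "\<tau> = (\<lambda>(b, c). restrict (\<lambda>(i, j). to_ac (rep b i) * to_ac (rep c j)) (S \<times> S))"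
  have S: "finite S"
    by (simp add: S_def finite_Bas_V)
  have F: "b \<noteq> 0" "c \<noteq> 0" "b \<in> V (deg a)" "c \<in> V (deg a)" if "(b, c) \<in> F" for b c
  proof -
    have bc: "b * c = a"
      using that by (simp add: F_def)
    then show "b \<noteq> 0" "c \<noteq> 0"
      using a by auto
    then show "b \<in> V (deg a)" "c \<in> V (deg a)"
      using deg_mult[of b c] bc by (auto simp: in_V_iff)
  qed
  have expand: "(\<Sum>s\<in>S. scale (rep v s) s) = v" if "v \<in> V (deg a)" for v
    unfolding S_def using that by (rule sum_rep)
  have "\<tau> ` F \<subseteq> PiE (S \<times> S) T"
  proof
    fix t
    assume "t \<in> \<tau> ` F"
    then obtain b c where bc: "(b, c) \<in> F" "t = \<tau> (b, c)"
      by auto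
    have "(\<Sum>s\<in>S. \<Sum>t\<in>S. to_ac (rep b s) * to_ac (rep c t) * to_ac (rep (s * t) g)) =
        to_ac (rep a g)" for g
    proof -
      have "a = (\<Sum>s\<in>S. scale (rep b s) s) * (\<Sum>t\<in>S. scale (rep c t) t)"
        using bc(1) F[OF bc(1)] by (simp add: expand F_def)
      also have "\<dots> = (\<Sum>s\<in>S. \<Sum>t\<in>S. scale (rep b s * rep c t) (s * t))"
        by (simp add: sum_product scale_mult_left scale_mult_right mult.commute)
      finally have "rep a g = (\<Sum>s\<in>S. \<Sum>t\<in>S. rep b s * rep c t * rep (s * t) g)"
        by (simp add: rep_sum rep_scale)
      then show ?thesis
        by (simp add: to_ac_sum)
    qed
    then have "to_ac (rep b i) * to_ac (rep c j) \<in> T (i, j)" for i j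
      unfolding T_def prod.case
      by (intro CollectI exI[of _ "\<lambda>i. to_ac (rep b i)"] exI[of _ "\<lambda>j. to_ac (rep c j)"]) simp
    with bc(2) show "t \<in> PiE (S \<times> S) T"
      by (auto simp: \<tau>_def)
  qed
  moreover have "finite (PiE (S \<times> S) T)"
  proof (rule finite_PiE)
    fix p
    assume "p \<in> S \<times> S"
    then obtain i j where p: "p = (i, j)" "i \<in> S" "j \<in> S"
      by blast
    show "finite (T p)"
      unfolding T_def p(1) prod.case
      by (rule finite_pure_tensors[OF S p(2,3)]) (use bilinear_nonzero in \<open>simp add: S_def\<close>)
  qed (simp add: S)
  ultimately have "finite (\<tau> ` F)"
    by (rule finite_subset)
  then have "finite ((fst \<circ> inv_into F \<tau>) ` (\<tau> ` F))"
    by blast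
  moreover have "\<exists>l\<in>(fst \<circ> inv_into F \<tau>) ` (\<tau> ` F). \<exists>\<kappa>. \<kappa> \<noteq> 0 \<and> b = scale \<kappa> l"
    if "b * c = a" for b c
  proof -
    have bc: "(b, c) \<in> F"
      using that by (simp add: F_def)
    obtain b' c' where b'c': "inv_into F \<tau> (\<tau> (b, c)) = (b', c')"
      by fastforce
    then have "(b', c') \<in> F" "\<tau> (b', c') = \<tau> (b, c)"
      using inv_into_into[of "\<tau> (b, c)" \<tau> F] f_inv_into_f[of "\<tau> (b, c)" \<tau> F] bc by auto
    then have prod: "rep b i * rep c j = rep b' i * rep c' j" if "i \<in> S" "j \<in> S" for i j
    proof -
      have "\<tau> (b, c) (i, j) = \<tau> (b', c') (i, j)"
        by (simp only: \<open>\<tau> (b', c') = \<tau> (b, c)\<close>)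
      then show ?thesis
        using that by (simp add: \<tau>_def flip: to_ac_mult)
    qed
    have "\<exists>j\<in>S. rep c j \<noteq> 0"
    proof (rule ccontr)
      assume "\<not> ?thesis"
      then have "(\<Sum>s\<in>S. scale (rep c s) s) = 0"
        by simp
      then show False
        using expand[of c] F[OF bc] by simp
    qed
    then obtain j where j: "j \<in> S" "rep c j \<noteq> 0"
      by blast
    define \<kappa> where "\<kappa> = rep c' j / rep c j"
    have "rep b i = \<kappa> * rep b' i" if "i \<in> S" for i
      using prod[OF that j(1)] j(2) by (simp add: \<kappa>_def field_simps)
    then have "b = scale \<kappa> (\<Sum>s\<in>S. scale (rep b' s) s)"
      using expand[of b] F[OF bc] by (simp add: scale_sum_right)
    also have "(\<Sum>s\<in>S. scale (rep b' s) s) = b'"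
      using expand[of b'] F[OF \<open>(b', c') \<in> F\<close>] by blast
    finally have "b = scale \<kappa> b'" .
    moreover from this have "\<kappa> \<noteq> 0"
      using F[OF bc] by auto
    moreover have "b' \<in> (fst \<circ> inv_into F \<tau>) ` (\<tau> ` F)"
      using bc b'c' by (force simp: image_iff)
    ultimately show ?thesis
      by blast
  qed
  ultimately show ?thesis
    by blast
qed

end


section \<open>Factorizations\<close>

lemma ring_of_type_algebra_simps:
  "carrier (ring_of_type_algebra :: 'a::ring_1 ring) = UNIV"
  "x \<otimes>\<^bsub>ring_of_type_algebra\<^esub> y = (x * y :: 'a)"
  "\<one>\<^bsub>ring_of_type_algebra\<^esub> = (1 :: 'a)"
  "\<zero>\<^bsub>ring_of_type_algebra\<^esub> = (0 :: 'a)"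
  "x \<oplus>\<^bsub>ring_of_type_algebra\<^esub> y = (x + y :: 'a)"
  by (simp_all add: ring_of_type_algebra_def)

lemma ring_ring_of_type_algebra: "ring (ring_of_type_algebra :: 'a::ring_1 ring)"
proof (rule ringI)
  show "abelian_group (ring_of_type_algebra :: 'a ring)"
  proof (rule abelian_groupI)
    fix x :: 'a
    show "\<exists>y\<in>carrier ring_of_type_algebra. y \<oplus>\<^bsub>ring_of_type_algebra\<^esub> x = \<zero>\<^bsub>ring_of_type_algebra\<^esub>"
      by (intro bexI[of _ "- x"]) (simp_all add: ring_of_type_algebra_simps)
  qed (simp_all add: ring_of_type_algebra_simps add_ac)
  show "Group.monoid (ring_of_type_algebra :: 'a ring)"
    by (rule monoidI) (simp_all add: ring_of_type_algebra_simps mult.assoc)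
qed (simp_all add: ring_of_type_algebra_simps distrib_left distrib_right)

context geometrically_integral_gr
begin

abbreviation A :: "'a ring" where
  "A \<equiv> ring_of_type_algebra"

lemma nc_domain_A: "nc_domain A"
proof (intro nc_domain.intro nc_domain_axioms.intro ring_ring_of_type_algebra)
  show "x = \<zero>\<^bsub>A\<^esub> \<or> y = \<zero>\<^bsub>A\<^esub>" if "x \<otimes>\<^bsub>A\<^esub> y = \<zero>\<^bsub>A\<^esub>" for x y
    using that mult_nonzero[of x y] by (auto simp: ring_of_type_algebra_simps)
qed (simp add: ring_of_type_algebra_simps one_neq_zero)

lemma mult_left_cancel: "u \<noteq> 0 \<Longrightarrow> u * v = u * w \<longleftrightarrow> v = (w::'a)"
  using mult_nonzero[of u "v - w"] by (auto simp: right_diff_distrib)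

lemma deg_one: "deg 1 = 0"
  using deg_mult[OF one_neq_zero one_neq_zero] by simp

lemma right_inverse_exists:
  assumes "u \<noteq> 0" "deg u = 0"
  shows "\<exists>w. u * w = 1"
proof -
  interpret mul: Vector_Spaces.linear scale scale "(*) u"
    by unfold_locales (simp_all add: distrib_left scale_mult_right)
  let ?S = "Bas \<inter> V 0"
  have S: "independent ?S" "finite ?S" "span ?S = V 0"
    using independent_mono[OF independent_Bas, of ?S] finite_Bas_V span_Bas_V by auto
  have inj: "inj ((*) u)"
    using assms(1) by (auto intro: injI simp: mult_left_cancel)
  have ind: "independent ((*) u ` ?S)"
    using S(1) inj by (intro mul.independent_inj_on_image) (auto intro: inj_on_subset)
  have "1 \<in> span ((*) u ` ?S)"
  proof (rule ccontr)
    assume not: "1 \<notin> span ((*) u ` ?S)"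
    then have "independent (insert 1 ((*) u ` ?S))"
      using ind by (intro independent_insertI)
    moreover have "insert 1 ((*) u ` ?S) \<subseteq> span ?S"
      using V_mult[of u 0 _ 0] assms(2) deg_one by (auto simp: S(3) in_V_iff[of u] in_V_iff[of 1])
    ultimately have "card (insert 1 ((*) u ` ?S)) \<le> card ?S"
      using independent_span_bound[OF S(2)] by blast
    moreover have "1 \<notin> (*) u ` ?S"
      using not span_superset[of "(*) u ` ?S"] by blast
    ultimately show False
      using S(2) card_image[OF inj_on_subset[OF inj subset_UNIV], of ?S] by simp
  qed
  then show ?thesis
    using mul.span_image[of ?S] by (auto simp: image_iff)
qed

lemma Units_A: "u \<in> Units A \<longleftrightarrow> u \<noteq> 0 \<and> deg u = 0"
proof
  assume "u \<in> Units A"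
  then obtain w where "w * u = 1"
    by (auto simp: Units_def ring_of_type_algebra_simps)
  moreover from this have "w \<noteq> 0" "u \<noteq> 0"
    using one_neq_zero by auto
  ultimately show "u \<noteq> 0 \<and> deg u = 0"
    using deg_mult[of w u] deg_one by simp
next
  assume u: "u \<noteq> 0 \<and> deg u = 0"
  then obtain w where w: "u * w = 1"
    using right_inverse_exists by blast
  then have "u * (w * u) = u * 1"
    by (simp flip: mult.assoc)
  then have "w * u = 1"
    using u mult_left_cancel by blast
  with w show "u \<in> Units A"
    by (auto simp: Units_def ring_of_type_algebra_simps)
qed

lemma central_units_A: "u \<in> central_units A \<longleftrightarrow> u \<noteq> 0 \<and> deg u = 0 \<and> (\<forall>x. u * x = x * u)"
  by (auto simp: central_units_def Units_A ring_of_type_algebra_simps)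

lemma scale_one_central_unit: "c \<noteq> 0 \<Longrightarrow> scale c 1 \<in> central_units A"
  using one_neq_zero by (simp add: central_units_A deg_scale deg_one scale_mult_left scale_mult_right)

lemma central_units_mult:
  assumes "u \<in> central_units A" "v \<in> central_units A"
  shows "u * v \<in> central_units A"
proof -
  have u: "u \<noteq> 0" "deg u = 0" "\<And>x. u * x = x * u" and v: "v \<noteq> 0" "deg v = 0" "\<And>x. v * x = x * v"
    using assms by (auto simp: central_units_A)
  have "u * v * x = x * (u * v)" for x
  proof -
    have "u * v * x = u * (x * v)"
      by (simp only: mult.assoc v(3)[of x])
    also have "\<dots> = x * (u * v)"
      by (simp only: mult.assoc[symmetric] u(3)[of x])
    finally show ?thesis .
  qed
  then show ?thesis
    using mult_nonzero[OF u(1) v(1)] deg_mult[OF u(1) v(1)] u(2) v(2)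
    unfolding central_units_A by simp
qed

lemma central_units_inverse:
  assumes "u \<in> central_units A"
  obtains w where "w \<in> central_units A" "w * u = 1"
proof -
  have u: "u \<noteq> 0" "deg u = 0" "\<And>x. u * x = x * u"
    using assms by (auto simp: central_units_A)
  then obtain w where w: "u * w = 1"
    using right_inverse_exists by blast
  then have "w \<noteq> 0"
    using one_neq_zero by auto
  moreover have "deg w = 0"
    using deg_mult[OF u(1) \<open>w \<noteq> 0\<close>] w deg_one by simp
  moreover have "w * x = x * w" for x
  proof -
    have "u * (x * w) = x * (u * w)"
      by (simp only: mult.assoc[symmetric] u(3)[of x])
    moreover have "u * (w * x) = x"
      by (simp only: mult.assoc[symmetric] w mult_1_left)
    ultimately have "u * (w * x) = u * (x * w)"
      using w by simp
    then show ?thesis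
      using mult_left_cancel[OF u(1)] by blast
  qed
  moreover have "w * u = 1"
    using w u(3)[of w] by simp
  ultimately show thesis
    using that[of w] unfolding central_units_A by blast
qed

definition associated :: "'a \<Rightarrow> 'a \<Rightarrow> bool" where
  "associated x y \<longleftrightarrow> (\<exists>u\<in>central_units A. y = u * x)"

lemma associated_sym: assumes "associated x y" shows "associated y x"
proof -
  obtain u where u: "u \<in> central_units A" "y = u * x"
    using assms by (auto simp: associated_def)
  obtain w where "w \<in> central_units A" "w * u = 1"
    using central_units_inverse[OF u(1)] .
  with u show ?thesis
    unfolding associated_def by (intro bexI[of _ w]) (simp_all flip: mult.assoc)
qed

lemma associated_trans: assumes "associated x y" "associated y z" shows "associated x z"
proof -
  obtain u v where uv: "u \<in> central_units A" "y = u * x" "v \<in> central_units A" "z = v * y"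
    using assms by (auto simp: associated_def)
  then show ?thesis
    unfolding associated_def
    by (intro bexI[of _ "v * u"]) (simp_all add: central_units_mult mult.assoc)
qed

lemma associated_scale: "c \<noteq> 0 \<Longrightarrow> associated x (scale c x)"
  unfolding associated_def
  by (intro bexI[of _ "scale c 1"]) (simp_all add: scale_mult_left scale_one_central_unit)

lemma nc_irreducible_A: "nc_irreducible A x \<longleftrightarrow>
    x \<noteq> 0 \<and> deg x > 0 \<and> (\<forall>b c. x = b * c \<longrightarrow> deg b = 0 \<or> deg c = 0)"
proof -
  have "(x = b * c \<longrightarrow> b \<in> Units A \<or> c \<in> Units A) \<longleftrightarrow> (x = b * c \<longrightarrow> deg b = 0 \<or> deg c = 0)"
    if "x \<noteq> 0" for b c
    using that by (auto simp: Units_A)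
  then show ?thesis
    by (cases "x = 0") (simp_all add: nc_irreducible_def ring_of_type_algebra_simps Units_A[of x])
qed

lemma factorizations_A: "factorizations A a =
    {xs. (\<forall>x\<in>set xs. nc_irreducible A x) \<and> prod_list xs = a}"
proof -
  have "foldr (\<lambda>x y. x \<otimes>\<^bsub>A\<^esub> y) xs \<one>\<^bsub>A\<^esub> = prod_list xs" for xs
    by (induction xs) (simp_all add: ring_of_type_algebra_simps)
  then show ?thesis
    by (simp add: factorizations_def)
qed

lemma factorizations_nonempty:
  assumes "a \<noteq> 0" "deg a > 0"
  shows "factorizations A a \<noteq> {}"
  using assms
proof (induction "deg a" arbitrary: a rule: less_induct)
  case less
  show ?case
  proof (cases "nc_irreducible A a")
    case True
    then have "[a] \<in> factorizations A a"
      by (simp add: factorizations_A)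
    then show ?thesis
      by blast
  next
    case False
    then obtain b c where bc: "a = b * c" "deg b > 0" "deg c > 0"
      using less.prems by (auto simp: nc_irreducible_A)
    then have nz: "b \<noteq> 0" "c \<noteq> 0"
      using less.prems by auto
    then have "deg b < deg a" "deg c < deg a"
      using bc by (simp_all add: deg_mult)
    then obtain xs ys where "xs \<in> factorizations A b" "ys \<in> factorizations A c"
      using less.hyps nz bc by blast
    then have "xs @ ys \<in> factorizations A a"
      by (auto simp: factorizations_A bc(1))
    then show ?thesis
      by blast
  qed
qed

lemma finite_factorizations_upto_scaling:
  assumes "a \<noteq> 0"
  shows "\<exists>R. finite R \<and> (\<forall>xs. (\<forall>x\<in>set xs. nc_irreducible A x) \<longrightarrow>
    (\<exists>\<mu>. \<mu> \<noteq> 0 \<and> prod_list xs = scale \<mu> a) \<longrightarrow> (\<exists>r\<in>R. list_all2 associated r xs))"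
  using assms
proof (induction "deg a" arbitrary: a rule: less_induct)
  case less
  define good where "good c R \<longleftrightarrow> finite R \<and> (\<forall>xs. (\<forall>x\<in>set xs. nc_irreducible A x) \<longrightarrow>
    (\<exists>\<mu>. \<mu> \<noteq> 0 \<and> prod_list xs = scale \<mu> c) \<longrightarrow> (\<exists>r\<in>R. list_all2 associated r xs))" for c R
  have "\<forall>c. \<exists>R. c \<noteq> 0 \<and> deg c < deg a \<longrightarrow> good c R"
    using less.hyps unfolding good_def by blast
  then obtain Rs where "\<forall>c. c \<noteq> 0 \<and> deg c < deg a \<longrightarrow> good c (Rs c)"
    by (rule choice[THEN exE])
  then have Rs: "\<And>c. c \<noteq> 0 \<Longrightarrow> deg c < deg a \<Longrightarrow> good c (Rs c)"
    by blast
  obtain L where L: "finite L" "\<And>b c. b * c = a \<Longrightarrow> \<exists>l\<in>L. \<exists>\<kappa>. \<kappa> \<noteq> 0 \<and> b = scale \<kappa> l"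
    using finite_left_factors[OF less.prems] by blast
  define cof where "cof l = (SOME c. l * c = a)" for l
  define L' where "L' = {l \<in> L. l * cof l = a \<and> deg l > 0}"
  have L': "cof l \<noteq> 0 \<and> deg (cof l) < deg a" if "l \<in> L'" for l
  proof -
    have l: "l * cof l = a" "deg l > 0"
      using that by (auto simp: L'_def)
    then have "l \<noteq> 0" "cof l \<noteq> 0"
      using less.prems by auto
    with l show ?thesis
      using deg_mult[of l "cof l"] by simp
  qed
  define R where "R = insert [] (\<Union>l\<in>L'. (#) l ` Rs (cof l))"
  have "finite R"
    unfolding R_def using L(1) Rs L' by (auto simp: L'_def good_def)
  moreover have "\<exists>r\<in>R. list_all2 associated r xs"
    if irr: "\<forall>x\<in>set xs. nc_irreducible A x" and \<mu>: "\<mu> \<noteq> 0" "prod_list xs = scale \<mu> a" for xs \<mu>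
  proof (cases xs)
    case Nil
    then show ?thesis
      by (auto simp: R_def)
  next
    case (Cons x ys)
    have "x * scale (inverse \<mu>) (prod_list ys) = a"
      using \<mu> Cons by (simp add: scale_mult_right)
    then obtain l \<kappa> where l: "l \<in> L" "\<kappa> \<noteq> 0" "x = scale \<kappa> l"
      using L(2) by blast
    define \<nu> where "\<nu> = \<kappa> * inverse \<mu>"
    have "\<nu> \<noteq> 0"
      using l(2) \<mu>(1) by (simp add: \<nu>_def)
    have ex: "l * scale \<nu> (prod_list ys) = a"
      using \<open>x * scale (inverse \<mu>) (prod_list ys) = a\<close> l(3)
      by (simp add: \<nu>_def scale_mult_left scale_mult_right mult.commute)
    then have cof: "l * cof l = a"
      unfolding cof_def by (rule someI)
    have "x \<noteq> 0" "deg x > 0"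
      using irr Cons by (auto simp: nc_irreducible_A)
    then have "l \<noteq> 0" "deg l > 0"
      using l by (auto simp: deg_scale)
    then have "l \<in> L'"
      using l(1) cof by (simp add: L'_def)
    have "scale \<nu> (prod_list ys) = cof l"
      using ex cof mult_left_cancel[OF \<open>l \<noteq> 0\<close>] by metis
    then have "prod_list ys = scale (inverse \<nu>) (cof l)"
      using \<open>\<nu> \<noteq> 0\<close> by (metis left_inverse scale_one scale_scale)
    moreover have "inverse \<nu> \<noteq> 0"
      using \<open>\<nu> \<noteq> 0\<close> by simp
    moreover have "\<forall>x\<in>set ys. nc_irreducible A x"
      using irr Cons by simp
    moreover have "good (cof l) (Rs (cof l))"
      using L'[OF \<open>l \<in> L'\<close>] Rs by blast
    ultimately obtain r where "r \<in> Rs (cof l)" "list_all2 associated r ys"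
      unfolding good_def by blast
    then have "l # r \<in> R" "list_all2 associated (l # r) xs"
      using \<open>l \<in> L'\<close> associated_scale[OF l(2), of l] l(3) by (auto simp: R_def Cons)
    then show ?thesis
      by blast
  qed
  ultimately show ?case
    by blast
qed

lemma finite_factorization_classes:
  assumes "a \<noteq> 0"
  shows "finite (factorizations A a // factorization_equiv A a)"
proof -
  define F where "F = factorizations A a"
  define E where "E = factorization_equiv A a"
  have E: "E = {(xs, ys). xs \<in> F \<and> ys \<in> F \<and> list_all2 associated xs ys}"
    by (simp add: E_def F_def factorization_equiv_def associated_def[abs_def]
        ring_of_type_algebra_simps)
  have sym: "list_all2 associated ys xs" if "list_all2 associated xs ys" for xs ys
    using that associated_sym by (metis list_all2_mono list_all2_conv_all_nth)
  have trans: "list_all2 associated xs zs"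
    if "list_all2 associated xs ys" "list_all2 associated ys zs" for xs ys zs
    using that associated_trans by (rule list_all2_trans[rotated])
  obtain R where R: "finite R" "\<And>xs. \<forall>x\<in>set xs. nc_irreducible A x \<Longrightarrow>
      \<exists>\<mu>. \<mu> \<noteq> 0 \<and> prod_list xs = scale \<mu> a \<Longrightarrow> \<exists>r\<in>R. list_all2 associated r xs"
    using finite_factorizations_upto_scaling[OF assms] by blast
  have "\<exists>r\<in>R. list_all2 associated r xs" if "xs \<in> F" for xs
  proof (rule R(2))
    show "\<forall>x\<in>set xs. nc_irreducible A x"
      using that by (simp add: F_def factorizations_A)
    show "\<exists>\<mu>. \<mu> \<noteq> 0 \<and> prod_list xs = scale \<mu> a"
      using that by (intro exI[of _ 1]) (simp add: F_def factorizations_A)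
  qed
  then have "\<forall>xs\<in>F. \<exists>r. r \<in> R \<and> list_all2 associated r xs"
    by blast
  then obtain \<rho> where "\<forall>xs\<in>F. \<rho> xs \<in> R \<and> list_all2 associated (\<rho> xs) xs"
    by (rule bchoice[THEN exE])
  then have \<rho>: "\<rho> xs \<in> R" "list_all2 associated (\<rho> xs) xs" if "xs \<in> F" for xs
    using that by blast+
  have class_eq: "E `` {xs} = E `` {ys}" if "xs \<in> F" "ys \<in> F" "\<rho> xs = \<rho> ys" for xs ys
  proof -
    have "list_all2 associated xs ys"
      using trans[OF sym[OF \<rho>(2)[OF that(1)]]] \<rho>(2)[OF that(2)] that(3) by simp
    then have "list_all2 associated xs zs \<longleftrightarrow> list_all2 associated ys zs" for zs
      using trans sym by blast
    then show ?thesis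
      using that by (auto simp: E)
  qed
  have "F // E \<subseteq> (\<lambda>r. E `` {inv_into F \<rho> r}) ` R"
  proof
    fix q
    assume "q \<in> F // E"
    then obtain xs where xs: "xs \<in> F" "q = E `` {xs}"
      by (rule quotientE)
    then have "inv_into F \<rho> (\<rho> xs) \<in> F" "\<rho> (inv_into F \<rho> (\<rho> xs)) = \<rho> xs"
      by (auto intro: inv_into_into f_inv_into_f)
    then have "q = E `` {inv_into F \<rho> (\<rho> xs)}"
      using class_eq xs by metis
    then show "q \<in> (\<lambda>r. E `` {inv_into F \<rho> r}) ` R"
      using \<rho>(1)[OF xs(1)] by blast
  qed
  then show ?thesis
    unfolding F_def[symmetric] E_def[symmetric] using R(1) by (rule finite_surj[rotated])
qed

lemma finite_factorization_domain_A: "finite_factorization_domain A"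
  unfolding finite_factorization_domain_def
proof (intro conjI ballI impI nc_domain_A)
  fix a
  assume "a \<noteq> \<zero>\<^bsub>A\<^esub> \<and> a \<notin> Units A"
  then have a: "a \<noteq> 0" "deg a > 0"
    by (auto simp: ring_of_type_algebra_simps Units_A)
  then show "factorizations A a \<noteq> {}"
    by (rule factorizations_nonempty)
  show "finite (factorizations A a // factorization_equiv A a)"
    using a(1) by (rule finite_factorization_classes)
qed

end

theorem corollary1p2:
  fixes scale :: "'k::field \<Rightarrow> 'a::ring_1 \<Rightarrow> 'a"
  assumes "k_algebra scale"
    and "\<exists>V. k_algebra.finite_dim_filtration scale V \<and>
             nc_domain (tensor_algebra (gr scale V) (alg_closure_algebra :: ('k, 'k alg_closure) module))"
  shows "finite_factorization_domain (ring_of_type_algebra :: 'a ring)"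
proof -
  obtain V where V: "k_algebra.finite_dim_filtration scale V"
    "nc_domain (tensor_algebra (gr scale V) (alg_closure_algebra :: ('k, 'k alg_closure) module))"
    using assms(2) by blast
  interpret geometrically_integral_gr scale V
    by (rule geometrically_integral_gr.intro[OF
          filtered_algebra.intro[OF assms(1) filtered_algebra_axioms.intro[OF V(1)]]
          geometrically_integral_gr_axioms.intro[OF V(2)]])
  show ?thesis
    by (rule finite_factorization_domain_A)
qed

end
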